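(* Let $L$ be a Lie ring, let $A$ be an abelian Lie ring, regarded as a trivial module over $L$ and over its quotients, and let $H$ be a central ideal of $L$ (i.e. an ideal with $H \subseteq Z(L)$). Let $0\to H\xrightarrow{i} L\xrightarrow{\pi} L/H\to 0$ be the corresponding natural exact sequence. Then the induced sequence of abelian groups \[ 0 \to \mathrm{Hom}(L/H,A)\xrightarrow{\mathrm{Inf}}\mathrm{Hom}(L,A)\xrightarrow{\mathrm{Res}}\mathrm{Hom}(H,A)\xrightarrow{\mathrm{Tra}}H^2(L/H,A)\xrightarrow{\mathrm{Inf}}H^2(L,A) \] is exact.
   Context: A Lie ring is an additive abelian group with a biadditive bracket $[\cdot,\cdot]$ satisfying $[x,x]=0$ and the Jacobi identity. It is abelian if its bracket is zero. $Z(L)=\{x\in L : [x,y]=0 \text{ for all } y\in L\}$. $\mathrm{Hom}(L,A)$ is the abelian group (under pointwise addition) of Lie ring homomorphisms from $L$ to the abelian Lie ring $A$. Cohomology. For a Lie ring $L$ and an abelian group $A$ (trivial $L$-module), $Z^2(L,A)$ is the abelian group (pointwise addition) of all pairs $(f,g)$ of functions $f,g:L\times L\to A$ (called cocycles) such that for all $x,y,z\in L$: (1) $f(x+y,z)=f(x,z)+f(y,z)+g([x,z],[y,z])$ and $f(x,y+z)=f(x,y)+f(x,z)+g([x,y],[x,z])$; (2) $f(x,x)=0$; (3) $f(x,[y,z])+f(z,[x,y])+f(y,[z,x])=-g([x,[y,z]],[z,[x,y]])-g(-[y,[z,x]],[y,[z,x]])$; (4) $g(x+y,z)+g(x,y)=g(x,y+z)+g(y,z)$;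 (5) $g(x,y)=g(y,x)$. $B^2(L,A)$ is the subgroup of coboundaries, i.e. the pairs $(f,g)$ of the form $f(x,y)=-t([x,y])$, $g(x,y)=t(x)+t(y)-t(x+y)$ for some map $t:L\to A$ with $t(0)=0$. $H^2(L,A)=Z^2(L,A)/B^2(L,A)$, and $\overline{(f,g)}$ denotes the class of $(f,g)$. Maps. $\mathrm{Inf}:\mathrm{Hom}(L/H,A)\to\mathrm{Hom}(L,A)$ is $\alpha\mapsto\alpha\circ\pi$. $\mathrm{Res}$ is restriction of homomorphisms to $H$. $\mathrm{Inf}:H^2(L/H,A)\to H^2(L,A)$ sends $\overline{(f,g)}$ to $\overline{(f',g')}$ with $f'(x,y)=f(\pi(x),\pi(y))$, $g'(x,y)=g(\pi(x),\pi(y))$. For $\mathrm{Tra}$ (transgression), choose a map $\lambda:L/H\to L$ with $\pi\circ\lambda=\mathrm{id}$ and $\lambda(0)=0$, and let $f,g:L/H\times L/H\to H$ be $f(x,y)=[\lambda(x),\lambda(y)]-\lambda([x,y])$, $g(x,y)=\lambda(x)+\lambda(y)-\lambda(x+y)$; then $\mathrm{Tra}(\chi)=\overline{(\chi\circ f,\chi\circ g)}$ for $\chi\in\mathrm{Hom}(H,A)$. This is a well-defined homomorphism, independent of $\lambda$. *)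

theory Defs
  imports "HOL-Algebra.Algebra"
begin

section \<open>Lie rings\<close>

text \<open>
  Lie rings are carried by the ring records of HOL-Algebra, with \<open>x \<otimes> y\<close> read as the
  Lie bracket \<open>[x, y]\<close>.  The field \<open>one\<close> of the record has no meaning for a Lie ring: it is
  neither constrained nor used.  In this way the notions of HOL-Algebra that concern the
  additive group (\<^locale>\<open>abelian_group\<close>, \<^locale>\<open>additive_subgroup\<close>, additive cosets) and the
  quotient \<^const>\<open>FactRing\<close>, written \<open>L Quot H\<close>, are available; the product of cosets in
  \<open>L Quot H\<close> is the induced bracket.
\<close>

locale lie_ring = abelian_group L for L (structure) +
  assumes bracket_closed:
      "\<lbrakk>x \<in> carrier L; y \<in> carrier L\<rbrakk> \<Longrightarrow> x \<otimes> y \<in> carrier L"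
    and bracket_add_left:
      "\<lbrakk>x \<in> carrier L; y \<in> carrier L; z \<in> carrier L\<rbrakk> \<Longrightarrow> (x \<oplus> y) \<otimes> z = x \<otimes> z \<oplus> y \<otimes> z"
    and bracket_add_right:
      "\<lbrakk>x \<in> carrier L; y \<in> carrier L; z \<in> carrier L\<rbrakk> \<Longrightarrow> x \<otimes> (y \<oplus> z) = x \<otimes> y \<oplus> x \<otimes> z"
    and bracket_self:
      "x \<in> carrier L \<Longrightarrow> x \<otimes> x = \<zero>"
    and jacobi:
      "\<lbrakk>x \<in> carrier L; y \<in> carrier L; z \<in> carrier L\<rbrakk>
        \<Longrightarrow> x \<otimes> (y \<otimes> z) \<oplus> y \<otimes> (z \<otimes> x) \<oplus> z \<otimes> (x \<otimes> y) = \<zero>"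

locale abelian_lie_ring = lie_ring +
  assumes bracket_zero: "\<lbrakk>x \<in> carrier L; y \<in> carrier L\<rbrakk> \<Longrightarrow> x \<otimes> y = \<zero>"

definition lie_center :: "('a, 'm) ring_scheme \<Rightarrow> 'a set" where
  "lie_center L = {x \<in> carrier L. \<forall>y \<in> carrier L. x \<otimes>\<^bsub>L\<^esub> y = \<zero>\<^bsub>L\<^esub>}"

locale lie_ideal = additive_subgroup H L for H and L (structure) +
  assumes bracket_left: "\<lbrakk>x \<in> carrier L; h \<in> H\<rbrakk> \<Longrightarrow> x \<otimes> h \<in> H"
    and bracket_right: "\<lbrakk>x \<in> carrier L; h \<in> H\<rbrakk> \<Longrightarrow> h \<otimes> x \<in> H"

locale central_lie_ideal = lie_ideal +
  assumes central: "H \<subseteq> lie_center L"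

abbreviation lie_subring :: "('a, 'm) ring_scheme \<Rightarrow> 'a set \<Rightarrow> ('a, 'm) ring_scheme" where
  "lie_subring L H \<equiv> L\<lparr>carrier := H\<rparr>"

abbreviation quot_map :: "('a, 'm) ring_scheme \<Rightarrow> 'a set \<Rightarrow> 'a \<Rightarrow> 'a set" where
  "quot_map L H x \<equiv> H +>\<^bsub>L\<^esub> x"


section \<open>Homomorphism groups\<close>

text \<open>
  Maps with domain \<open>carrier L\<close> are taken to be extensional (undefined outside of the
  carrier), so that equality of elements of the groups below is equality of maps on the
  carrier.  The same convention is used for cocycles, with domain
  \<open>carrier L \<times> carrier L\<close>.
\<close>

definition lie_hom :: "('a, 'm) ring_scheme \<Rightarrow> ('b, 'n) ring_scheme \<Rightarrow> ('a \<Rightarrow> 'b) set" where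
  "lie_hom L A = {h \<in> carrier L \<rightarrow>\<^sub>E carrier A. \<forall>x \<in> carrier L. \<forall>y \<in> carrier L.
      h (x \<oplus>\<^bsub>L\<^esub> y) = h x \<oplus>\<^bsub>A\<^esub> h y \<and> h (x \<otimes>\<^bsub>L\<^esub> y) = h x \<otimes>\<^bsub>A\<^esub> h y}"

definition lie_Hom :: "('a, 'm) ring_scheme \<Rightarrow> ('b, 'n) ring_scheme \<Rightarrow> ('a \<Rightarrow> 'b) monoid" where
  "lie_Hom L A = \<lparr>carrier = lie_hom L A,
     monoid.mult = (\<lambda>h k. \<lambda>x \<in> carrier L. h x \<oplus>\<^bsub>A\<^esub> k x),
     one = (\<lambda>x \<in> carrier L. \<zero>\<^bsub>A\<^esub>)\<rparr>"


section \<open>Second cohomology with trivial coefficients\<close>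

definition cocycles ::
  "('a, 'm) ring_scheme \<Rightarrow> ('b, 'n) ring_scheme \<Rightarrow> (('a \<times> 'a \<Rightarrow> 'b) \<times> ('a \<times> 'a \<Rightarrow> 'b)) set" where
  "cocycles L A = {(f, g).
     f \<in> carrier L \<times> carrier L \<rightarrow>\<^sub>E carrier A \<and>
     g \<in> carrier L \<times> carrier L \<rightarrow>\<^sub>E carrier A \<and>
     (\<forall>x \<in> carrier L. \<forall>y \<in> carrier L. \<forall>z \<in> carrier L.
        f (x \<oplus>\<^bsub>L\<^esub> y, z) = f (x, z) \<oplus>\<^bsub>A\<^esub> f (y, z) \<oplus>\<^bsub>A\<^esub> g (x \<otimes>\<^bsub>L\<^esub> z, y \<otimes>\<^bsub>L\<^esub> z) \<and>
        f (x, y \<oplus>\<^bsub>L\<^esub> z) = f (x, y) \<oplus>\<^bsub>A\<^esub> f (x, z) \<oplus>\<^bsub>A\<^esub> g (x \<otimes>\<^bsub>L\<^esub> y, x \<otimes>\<^bsub>L\<^esub> z) \<and>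
        f (x, x) = \<zero>\<^bsub>A\<^esub> \<and>
        f (x, y \<otimes>\<^bsub>L\<^esub> z) \<oplus>\<^bsub>A\<^esub> f (z, x \<otimes>\<^bsub>L\<^esub> y) \<oplus>\<^bsub>A\<^esub> f (y, z \<otimes>\<^bsub>L\<^esub> x) =
          (\<ominus>\<^bsub>A\<^esub> g (x \<otimes>\<^bsub>L\<^esub> (y \<otimes>\<^bsub>L\<^esub> z), z \<otimes>\<^bsub>L\<^esub> (x \<otimes>\<^bsub>L\<^esub> y)))
            \<ominus>\<^bsub>A\<^esub> g (\<ominus>\<^bsub>L\<^esub> (y \<otimes>\<^bsub>L\<^esub> (z \<otimes>\<^bsub>L\<^esub> x)), y \<otimes>\<^bsub>L\<^esub> (z \<otimes>\<^bsub>L\<^esub> x)) \<and>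
        g (x \<oplus>\<^bsub>L\<^esub> y, z) \<oplus>\<^bsub>A\<^esub> g (x, y) = g (x, y \<oplus>\<^bsub>L\<^esub> z) \<oplus>\<^bsub>A\<^esub> g (y, z) \<and>
        g (x, y) = g (y, x))}"

definition Z2 ::
  "('a, 'm) ring_scheme \<Rightarrow> ('b, 'n) ring_scheme \<Rightarrow> (('a \<times> 'a \<Rightarrow> 'b) \<times> ('a \<times> 'a \<Rightarrow> 'b)) monoid" where
  "Z2 L A = \<lparr>carrier = cocycles L A,
     monoid.mult = (\<lambda>(f, g) (f', g').
       (\<lambda>p \<in> carrier L \<times> carrier L. f p \<oplus>\<^bsub>A\<^esub> f' p, \<lambda>p \<in> carrier L \<times> carrier L. g p \<oplus>\<^bsub>A\<^esub> g' p)),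
     one = (\<lambda>p \<in> carrier L \<times> carrier L. \<zero>\<^bsub>A\<^esub>, \<lambda>p \<in> carrier L \<times> carrier L. \<zero>\<^bsub>A\<^esub>)\<rparr>"

definition coboundary ::
  "('a, 'm) ring_scheme \<Rightarrow> ('b, 'n) ring_scheme \<Rightarrow> ('a \<Rightarrow> 'b) \<Rightarrow> ('a \<times> 'a \<Rightarrow> 'b) \<times> ('a \<times> 'a \<Rightarrow> 'b)" where
  "coboundary L A t =
     (\<lambda>(x, y) \<in> carrier L \<times> carrier L. \<ominus>\<^bsub>A\<^esub> t (x \<otimes>\<^bsub>L\<^esub> y),
      \<lambda>(x, y) \<in> carrier L \<times> carrier L. t x \<oplus>\<^bsub>A\<^esub> t y \<ominus>\<^bsub>A\<^esub> t (x \<oplus>\<^bsub>L\<^esub> y))"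

definition B2 ::
  "('a, 'm) ring_scheme \<Rightarrow> ('b, 'n) ring_scheme \<Rightarrow> (('a \<times> 'a \<Rightarrow> 'b) \<times> ('a \<times> 'a \<Rightarrow> 'b)) set" where
  "B2 L A = {coboundary L A t |t. t \<in> carrier L \<rightarrow> carrier A \<and> t \<zero>\<^bsub>L\<^esub> = \<zero>\<^bsub>A\<^esub>}"

definition H2 ::
  "('a, 'm) ring_scheme \<Rightarrow> ('b, 'n) ring_scheme \<Rightarrow> (('a \<times> 'a \<Rightarrow> 'b) \<times> ('a \<times> 'a \<Rightarrow> 'b)) set monoid" where
  "H2 L A = Z2 L A Mod B2 L A"

definition H2_class ::
  "('a, 'm) ring_scheme \<Rightarrow> ('b, 'n) ring_scheme \<Rightarrow> ('a \<times> 'a \<Rightarrow> 'b) \<times> ('a \<times> 'a \<Rightarrow> 'b)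
    \<Rightarrow> (('a \<times> 'a \<Rightarrow> 'b) \<times> ('a \<times> 'a \<Rightarrow> 'b)) set" where
  "H2_class L A c = B2 L A #>\<^bsub>Z2 L A\<^esub> c"


section \<open>The maps of the sequence\<close>

definition Inf_Hom ::
  "('a, 'm) ring_scheme \<Rightarrow> 'a set \<Rightarrow> ('a set \<Rightarrow> 'b) \<Rightarrow> 'a \<Rightarrow> 'b" where
  "Inf_Hom L H \<alpha> = (\<lambda>x \<in> carrier L. \<alpha> (quot_map L H x))"

definition Res_Hom :: "'a set \<Rightarrow> ('a \<Rightarrow> 'b) \<Rightarrow> 'a \<Rightarrow> 'b" where
  "Res_Hom H \<beta> = (\<lambda>x \<in> H. \<beta> x)"

definition inflate_cocycle ::
  "('a, 'm) ring_scheme \<Rightarrow> 'a set \<Rightarrow> ('a set \<times> 'a set \<Rightarrow> 'b) \<times> ('a set \<times> 'a set \<Rightarrow> 'b)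
    \<Rightarrow> ('a \<times> 'a \<Rightarrow> 'b) \<times> ('a \<times> 'a \<Rightarrow> 'b)" where
  "inflate_cocycle L H c =
     (\<lambda>(x, y) \<in> carrier L \<times> carrier L. fst c (quot_map L H x, quot_map L H y),
      \<lambda>(x, y) \<in> carrier L \<times> carrier L. snd c (quot_map L H x, quot_map L H y))"

text \<open>
  As in \<^const>\<open>rcoset_mult\<close>, the induced map on classes is written as the union over all
  representatives \<open>c\<close> of the class \<open>C\<close>; it is a single class because the class of the
  inflated cocycle does not depend on the representative.
\<close>

definition Inf_H2 ::
  "('a, 'm) ring_scheme \<Rightarrow> 'a set \<Rightarrow> ('b, 'n) ring_scheme
    \<Rightarrow> (('a set \<times> 'a set \<Rightarrow> 'b) \<times> ('a set \<times> 'a set \<Rightarrow> 'b)) set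
    \<Rightarrow> (('a \<times> 'a \<Rightarrow> 'b) \<times> ('a \<times> 'a \<Rightarrow> 'b)) set" where
  "Inf_H2 L H A C = (\<Union>c \<in> C. H2_class L A (inflate_cocycle L H c))"

definition lie_section :: "('a, 'm) ring_scheme \<Rightarrow> 'a set \<Rightarrow> ('a set \<Rightarrow> 'a) \<Rightarrow> bool" where
  "lie_section L H l \<longleftrightarrow>
     l \<in> carrier (L Quot H) \<rightarrow> carrier L \<and>
     (\<forall>u \<in> carrier (L Quot H). quot_map L H (l u) = u) \<and>
     l \<zero>\<^bsub>L Quot H\<^esub> = \<zero>\<^bsub>L\<^esub>"

definition section_bracket ::
  "('a, 'm) ring_scheme \<Rightarrow> 'a set \<Rightarrow> ('a set \<Rightarrow> 'a) \<Rightarrow> 'a set \<times> 'a set \<Rightarrow> 'a" where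
  "section_bracket L H l = (\<lambda>(u, v). l u \<otimes>\<^bsub>L\<^esub> l v \<ominus>\<^bsub>L\<^esub> l (u \<otimes>\<^bsub>L Quot H\<^esub> v))"

definition section_add ::
  "('a, 'm) ring_scheme \<Rightarrow> 'a set \<Rightarrow> ('a set \<Rightarrow> 'a) \<Rightarrow> 'a set \<times> 'a set \<Rightarrow> 'a" where
  "section_add L H l = (\<lambda>(u, v). l u \<oplus>\<^bsub>L\<^esub> l v \<ominus>\<^bsub>L\<^esub> l (u \<oplus>\<^bsub>L Quot H\<^esub> v))"

definition Tra ::
  "('a, 'm) ring_scheme \<Rightarrow> 'a set \<Rightarrow> ('b, 'n) ring_scheme \<Rightarrow> ('a set \<Rightarrow> 'a) \<Rightarrow> ('a \<Rightarrow> 'b)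
    \<Rightarrow> (('a set \<times> 'a set \<Rightarrow> 'b) \<times> ('a set \<times> 'a set \<Rightarrow> 'b)) set" where
  "Tra L H A l \<chi> = H2_class (L Quot H) A
     (\<lambda>p \<in> carrier (L Quot H) \<times> carrier (L Quot H). \<chi> (section_bracket L H l p),
      \<lambda>p \<in> carrier (L Quot H) \<times> carrier (L Quot H). \<chi> (section_add L H l p))"


section \<open>Exactness\<close>

text \<open>
  The library's \<^const>\<open>exact_seq\<close> requires all groups to have elements of one type.
\<close>

definition exact_at ::
  "('a, 'k) monoid_scheme \<Rightarrow> ('a \<Rightarrow> 'b) \<Rightarrow> ('b, 'm) monoid_scheme \<Rightarrow> ('b \<Rightarrow> 'c)
    \<Rightarrow> ('c, 'n) monoid_scheme \<Rightarrow> bool" where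
  "exact_at F u G v K \<longleftrightarrow>
     group_hom F G u \<and> group_hom G K v \<and> u ` carrier F = kernel G K v"

end

theory Submission
  imports Defs
begin

text \<open>
  A section \<open>s\<close> of \<open>L \<rightarrow> L/H\<close> fails to be a homomorphism by a pair of functions with values in the central
  ideal \<open>H\<close>, and this pair satisfies the cocycle identities. If \<open>\<chi>\<close> on \<open>H\<close> composed with this pair is the
  coboundary of \<open>t\<close>, then \<open>x \<mapsto> \<chi> (x - s (\<pi> x)) + t (\<pi> x)\<close> is a homomorphism extending \<open>\<chi>\<close>; this gives exactness
  at \<open>Hom(H, A)\<close>. If the inflation of \<open>(f, g)\<close> is the coboundary of \<open>t\<close>, then \<open>t\<close> is additive on
  translates by \<open>H\<close>, and \<open>(f, g)\<close> differs from the transgression cocycle of \<open>\<chi> = -t\<close> by the coboundary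
  of \<open>t \<circ> s\<close>; this gives exactness at \<open>H\<^sup>2(L/H, A)\<close>.
\<close>

text \<open>Centrality acts through one fact: an element of \<open>H\<close> contributes nothing to
  a bracket, so [x, y] is determined as an element of \<open>L\<close>, and not merely modulo
  \<open>H\<close>, by the cosets of x and y. This gives the cocycle identities that involve
  brackets, and it gives [x, y] = [s (\<pi> x), s (\<pi> y)] when a homomorphism is extended from
  \<open>H\<close> to \<open>L\<close>.

  The formula for the extension comes from x = (x - s (\<pi> x)) + s (\<pi> x), which identifies
  \<open>L\<close> as a set with \<open>H\<close> times \<open>L/H\<close>, the addition and bracket
  being twisted by the defect pair of s. A map t whose coboundary is the image of that pair under
  \<chi> prescribes values on the section that undo the twist in \<open>A\<close>.

  At the last place, t is additive on translates because (h, x) and (0, x) have the same image in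
  \<open>L/H\<close>, so the second component of the inflated cocycle agrees on them. The sign in
  \<chi> = -t arises because a coboundary subtracts t at [x, y] and at x + y: replacing t (s [u, v])
  by t [s u, s v] there, and likewise for sums, changes the value by -t of the defect.\<close>

lemma (in abelian_group) minus_zero: "\<ominus> \<zero> = \<zero>"
  by (rule minus_equality) simp_all

text \<open>The normalisation method for rings in HOL-Algebra requires an associative product with a unit,
  so abelian groups and Lie rings are registered separately.\<close>

lemmas (in abelian_group) abelian_group_simprules
  [algebra abelian_group "\<zero>" "add G" "a_inv G" "a_minus G"] =
  a_closed zero_closed a_inv_closed minus_closed
  a_assoc l_zero l_neg a_comm minus_eq
  r_zero r_neg r_neg2 r_neg1 minus_add minus_minus minus_zero a_lcomm

section \<open>Elementary identities for the bracket\<close>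

context lie_ring
begin

lemma bracket_zero_left [simp]:
  assumes "x \<in> carrier L" shows "\<zero> \<otimes> x = \<zero>"
proof -
  have "\<zero> \<otimes> x \<oplus> \<zero> \<otimes> x = (\<zero> \<oplus> \<zero>) \<otimes> x"
    using assms bracket_add_left[of \<zero> \<zero> x] by simp
  then show ?thesis
    using assms add.l_cancel_one'[of "\<zero> \<otimes> x" "\<zero> \<otimes> x"] by (simp add: bracket_closed)
qed

lemma bracket_zero_right [simp]:
  assumes "x \<in> carrier L" shows "x \<otimes> \<zero> = \<zero>"
proof -
  have "x \<otimes> \<zero> \<oplus> x \<otimes> \<zero> = x \<otimes> (\<zero> \<oplus> \<zero>)"
    using assms bracket_add_right[of x \<zero> \<zero>] by simp
  then show ?thesis
    using assms add.l_cancel_one'[of "x \<otimes> \<zero>" "x \<otimes> \<zero>"] by (simp add: bracket_closed)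
qed

lemma bracket_minus_left:
  assumes "x \<in> carrier L" "y \<in> carrier L" shows "\<ominus> x \<otimes> y = \<ominus> (x \<otimes> y)"
proof -
  have "\<ominus> x \<otimes> y \<oplus> x \<otimes> y = \<zero>"
    using assms bracket_add_left[of "\<ominus> x" x y] by (simp add: l_neg)
  then show ?thesis
    using assms minus_equality by (simp add: bracket_closed)
qed

lemma bracket_minus_right:
  assumes "x \<in> carrier L" "y \<in> carrier L" shows "x \<otimes> \<ominus> y = \<ominus> (x \<otimes> y)"
proof -
  have "x \<otimes> \<ominus> y \<oplus> x \<otimes> y = \<zero>"
    using assms bracket_add_right[of x "\<ominus> y" y] by (simp add: l_neg)
  then show ?thesis
    using assms minus_equality by (simp add: bracket_closed)
qed

end

lemmas (in lie_ring) lie_ring_simprules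
  [algebra lie_ring "\<zero>" "add L" "a_inv L" "a_minus L" "monoid.mult L"] =
  a_closed zero_closed a_inv_closed minus_closed bracket_closed
  a_assoc l_zero l_neg a_comm minus_eq
  r_zero r_neg r_neg2 r_neg1 minus_add minus_minus minus_zero a_lcomm
  bracket_add_left bracket_add_right bracket_minus_left bracket_minus_right
  bracket_zero_left bracket_zero_right

text \<open>Polarisation: expanding [x + y, x + y] leaves the two mixed terms once the squares, all
  of which vanish, are removed.\<close>

lemma (in lie_ring) bracket_anticomm:
  assumes "x \<in> carrier L" "y \<in> carrier L" shows "x \<otimes> y = \<ominus> (y \<otimes> x)"
proof -
  have "x \<otimes> y \<oplus> y \<otimes> x = (x \<oplus> y) \<otimes> (x \<oplus> y) \<ominus> x \<otimes> x \<ominus> y \<otimes> y"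
    using assms by algebra
  also have "\<dots> = \<zero>"
    using assms by (simp add: bracket_self minus_eq minus_zero)
  finally show ?thesis
    using assms minus_equality by (simp add: bracket_closed)
qed

section \<open>Ideals and the quotient Lie ring\<close>

locale lie_ring_ideal = lie_ring L + lie_ideal H L for H and L (structure)

sublocale lie_ring_ideal \<subseteq> abelian_subgroup H L
  by (intro abelian_subgroupI3 additive_subgroup_axioms abelian_group_axioms)

context lie_ring_ideal
begin

lemma rcos_eq_iff:
  assumes "x \<in> carrier L" "y \<in> carrier L"
  shows "H +> x = H +> y \<longleftrightarrow> x \<ominus> y \<in> H"
  by (metis a_rcos_module a_rcos_self a_repr_independence' a_subgroup abelian_group_axioms assms minus_eq)

lemma carrier_Quot: "carrier (L Quot H) = (\<lambda>x. H +> x) ` carrier L"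
  by (auto simp: FactRing_def A_RCOSETS_def')

lemma rcos_closed: "x \<in> carrier L \<Longrightarrow> H +> x \<in> carrier (L Quot H)"
  by (simp add: carrier_Quot)

lemma zero_Quot: "\<zero>\<^bsub>L Quot H\<^esub> = H +> \<zero>"
  using a_coset_add_zero[OF a_subset] by (simp add: FactRing_def)

lemma add_Quot:
  "\<lbrakk>x \<in> carrier L; y \<in> carrier L\<rbrakk> \<Longrightarrow> (H +> x) \<oplus>\<^bsub>L Quot H\<^esub> (H +> y) = H +> (x \<oplus> y)"
  by (simp add: FactRing_def a_rcos_sum)

text \<open>Changing the representatives by h and k in \<open>H\<close> changes the bracket by
  [h, b] + [x, k], and both terms stay in the ideal. This is what collapses the union over
  representatives by which \<open>FactRing\<close> defines the product of cosets.\<close>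

lemma bracket_rcos_eq:
  assumes "x \<in> carrier L" "y \<in> carrier L" "a \<in> H +> x" "b \<in> H +> y"
  shows "H +> a \<otimes> b = H +> x \<otimes> y"
proof -
  obtain h k where hk: "h \<in> H" "k \<in> H" "a = h \<oplus> x" "b = k \<oplus> y"
    using assms by (auto simp: a_r_coset_def')
  then have c: "h \<in> carrier L" "k \<in> carrier L" by auto
  have "a \<otimes> b \<ominus> x \<otimes> y = h \<otimes> b \<oplus> x \<otimes> k"
    unfolding hk using c assms(1,2) by algebra
  moreover have "h \<otimes> b \<oplus> x \<otimes> k \<in> H"
    using hk c assms by (simp add: bracket_left bracket_right)
  ultimately show ?thesis
    using hk c assms by (simp add: rcos_eq_iff bracket_closed)
qed

lemma bracket_Quot:
  assumes "x \<in> carrier L" "y \<in> carrier L"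
  shows "(H +> x) \<otimes>\<^bsub>L Quot H\<^esub> (H +> y) = H +> (x \<otimes> y)"
proof -
  \<comment> \<open>All members of the union are one and the same coset; the index sets are nonempty
    because x and y lie in their own cosets.\<close>
  have "(\<Union>a\<in>H +> x. \<Union>b\<in>H +> y. H +> a \<otimes> b) = (\<Union>a\<in>H +> x. \<Union>b\<in>H +> y. H +> x \<otimes> y)"
    using bracket_rcos_eq[OF assms] by simp
  then show ?thesis
    using a_rcos_self[OF assms(1)] a_rcos_self[OF assms(2)] by (auto simp: FactRing_def rcoset_mult_def)
qed

lemma lie_ring_Quot: "lie_ring (L Quot H)"
proof -
  have "abelian_group (L Quot H)"
    by (rule comm_group_abelian_groupI)
      (simp add: FactRing_def a_factorgroup_is_comm_group[unfolded A_FactGroup_def'])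
  then show ?thesis
    by (intro lie_ring.intro lie_ring_axioms.intro)
      (auto simp: carrier_Quot add_Quot bracket_Quot zero_Quot bracket_closed bracket_add_left
        bracket_add_right bracket_self jacobi)
qed

lemma lie_ring_subring: "lie_ring (lie_subring L H)"
proof (intro lie_ring.intro lie_ring_axioms.intro abelian_groupI)
  fix x assume x: "x \<in> carrier (lie_subring L H)"
  then have "\<ominus> x \<in> H" "\<ominus> x \<oplus> x = \<zero>" by (auto simp: l_neg)
  then show "\<exists>y\<in>carrier (lie_subring L H). y \<oplus>\<^bsub>lie_subring L H\<^esub> x = \<zero>\<^bsub>lie_subring L H\<^esub>"
    by auto
qed (auto simp: bracket_add_left bracket_add_right bracket_self jacobi bracket_left intro: a_assoc a_comm)

end

section \<open>Central ideals\<close>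

locale lie_ring_central_ideal = lie_ring L + central_lie_ideal H L for H and L (structure)

sublocale lie_ring_central_ideal \<subseteq> lie_ring_ideal ..

context lie_ring_central_ideal
begin

lemma bracket_central_left: "\<lbrakk>h \<in> H; x \<in> carrier L\<rbrakk> \<Longrightarrow> h \<otimes> x = \<zero>"
  using central by (auto simp: lie_center_def)

text \<open>The center is defined by brackets with the central element on the left;
  anticommutativity supplies the other side.\<close>

lemma bracket_central_right: "\<lbrakk>x \<in> carrier L; h \<in> H\<rbrakk> \<Longrightarrow> x \<otimes> h = \<zero>"
  using bracket_anticomm[of x h] by (simp add: bracket_central_left)

text \<open>Moving from (x, y) to (x', y') one argument at a time produces two error terms, each
  with an entry in \<open>H\<close>, hence zero. The bracket therefore descends to a map on pairs of
  cosets with values in \<open>L\<close> itself, whereas for a general ideal only the class of the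
  bracket modulo \<open>H\<close> is determined.\<close>

lemma bracket_cong_central:
  assumes "x \<in> carrier L" "x' \<in> carrier L" "y \<in> carrier L" "y' \<in> carrier L"
    and "x \<ominus> x' \<in> H" "y \<ominus> y' \<in> H"
  shows "x \<otimes> y = x' \<otimes> y'"
proof -
  have "x \<otimes> y = (x \<ominus> x') \<otimes> y \<oplus> x' \<otimes> (y \<ominus> y') \<oplus> x' \<otimes> y'"
    using assms(1-4) by algebra
  also have "\<dots> = x' \<otimes> y'"
    using assms by (simp add: bracket_central_left bracket_central_right bracket_closed)
  finally show ?thesis .
qed

end

section \<open>Homomorphisms into an abelian Lie ring\<close>

locale lie_trivial_coefficients = lie_ring L + A: abelian_lie_ring A
  for L :: "('a, 'm) ring_scheme" (structure) and A :: "('b, 'n) ring_scheme"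
begin

lemma funcset_mem: "\<lbrakk>h \<in> carrier L \<rightarrow>\<^sub>E carrier A; x \<in> carrier L\<rbrakk> \<Longrightarrow> h x \<in> carrier A"
  by auto

text \<open>Since brackets in \<open>A\<close> vanish, compatibility with the bracket means killing
  all brackets; the later proofs work with this form.\<close>

lemma lie_hom_iff:
  "h \<in> lie_hom L A \<longleftrightarrow> h \<in> carrier L \<rightarrow>\<^sub>E carrier A \<and>
    (\<forall>x \<in> carrier L. \<forall>y \<in> carrier L. h (x \<oplus> y) = h x \<oplus>\<^bsub>A\<^esub> h y \<and> h (x \<otimes> y) = \<zero>\<^bsub>A\<^esub>)"
  by (auto simp: lie_hom_def A.bracket_zero funcset_mem)

lemma
  assumes "h \<in> lie_hom L A" "x \<in> carrier L"
  shows hom_closed: "h x \<in> carrier A"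
    and hom_add: "y \<in> carrier L \<Longrightarrow> h (x \<oplus> y) = h x \<oplus>\<^bsub>A\<^esub> h y"
    and hom_bracket: "y \<in> carrier L \<Longrightarrow> h (x \<otimes> y) = \<zero>\<^bsub>A\<^esub>"
  using assms by (auto simp: lie_hom_iff)

lemma hom_zero:
  assumes "h \<in> lie_hom L A" shows "h \<zero> = \<zero>\<^bsub>A\<^esub>"
  using hom_bracket[OF assms, of \<zero> \<zero>] by simp

lemma hom_minus:
  assumes "h \<in> lie_hom L A" "x \<in> carrier L" shows "h (\<ominus> x) = \<ominus>\<^bsub>A\<^esub> h x"
proof -
  have "h (\<ominus> x) \<oplus>\<^bsub>A\<^esub> h x = \<zero>\<^bsub>A\<^esub>"
    using hom_add[OF assms(1), of "\<ominus> x" x] assms by (simp add: l_neg hom_zero)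
  then show ?thesis
    using A.minus_equality assms by (simp add: hom_closed)
qed

lemma lie_Hom_simps:
  "carrier (lie_Hom L A) = lie_hom L A"
  "h \<otimes>\<^bsub>lie_Hom L A\<^esub> k = (\<lambda>x \<in> carrier L. h x \<oplus>\<^bsub>A\<^esub> k x)"
  "\<one>\<^bsub>lie_Hom L A\<^esub> = (\<lambda>x \<in> carrier L. \<zero>\<^bsub>A\<^esub>)"
  by (simp_all add: lie_Hom_def)

lemma comm_group_lie_Hom: "comm_group (lie_Hom L A)"
proof (rule comm_groupI; (unfold lie_Hom_simps)?)
  fix h assume h: "h \<in> lie_hom L A"
  then have ext: "h \<in> extensional (carrier L)"
    by (auto simp: lie_hom_def PiE_def)
  show "(\<lambda>x\<in>carrier L. (\<lambda>x\<in>carrier L. \<zero>\<^bsub>A\<^esub>) x \<oplus>\<^bsub>A\<^esub> h x) = h"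
    by (rule extensionalityI[OF _ ext]) (auto simp: hom_closed h)
  have "(\<lambda>x\<in>carrier L. \<ominus>\<^bsub>A\<^esub> h x) \<in> lie_hom L A"
    using h by (auto simp: lie_hom_iff bracket_closed A.minus_add A.a_ac funcset_mem)
  moreover have "(\<lambda>x\<in>carrier L. (\<lambda>x\<in>carrier L. \<ominus>\<^bsub>A\<^esub> h x) x \<oplus>\<^bsub>A\<^esub> h x) = (\<lambda>x\<in>carrier L. \<zero>\<^bsub>A\<^esub>)"
    by (rule restrict_ext) (auto simp: hom_closed h A.l_neg)
  ultimately show "\<exists>k\<in>lie_hom L A. (\<lambda>x\<in>carrier L. k x \<oplus>\<^bsub>A\<^esub> h x) = (\<lambda>x\<in>carrier L. \<zero>\<^bsub>A\<^esub>)"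
    by blast
  fix k assume k: "k \<in> lie_hom L A"
  show "(\<lambda>x\<in>carrier L. h x \<oplus>\<^bsub>A\<^esub> k x) \<in> lie_hom L A"
    using h k by (auto simp: lie_hom_iff bracket_closed A.a_ac funcset_mem)
  show "(\<lambda>x\<in>carrier L. h x \<oplus>\<^bsub>A\<^esub> k x) = (\<lambda>x\<in>carrier L. k x \<oplus>\<^bsub>A\<^esub> h x)"
    by (rule restrict_ext) (auto simp: hom_closed h k A.a_comm)
  fix m assume m: "m \<in> lie_hom L A"
  show "(\<lambda>x\<in>carrier L. (\<lambda>x\<in>carrier L. h x \<oplus>\<^bsub>A\<^esub> k x) x \<oplus>\<^bsub>A\<^esub> m x) =
    (\<lambda>x\<in>carrier L. h x \<oplus>\<^bsub>A\<^esub> (\<lambda>x\<in>carrier L. k x \<oplus>\<^bsub>A\<^esub> m x) x)"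
    by (rule restrict_ext) (auto simp: hom_closed h k m A.a_assoc)
next
  show "(\<lambda>x\<in>carrier L. \<zero>\<^bsub>A\<^esub>) \<in> lie_hom L A"
    by (auto simp: lie_hom_iff bracket_closed)
qed

section \<open>The group of cocycles\<close>

lemma Z2_simps:
  "carrier (Z2 L A) = cocycles L A"
  "c \<otimes>\<^bsub>Z2 L A\<^esub> c' = (\<lambda>p \<in> carrier L \<times> carrier L. fst c p \<oplus>\<^bsub>A\<^esub> fst c' p,
     \<lambda>p \<in> carrier L \<times> carrier L. snd c p \<oplus>\<^bsub>A\<^esub> snd c' p)"
  "\<one>\<^bsub>Z2 L A\<^esub> = (\<lambda>p \<in> carrier L \<times> carrier L. \<zero>\<^bsub>A\<^esub>, \<lambda>p \<in> carrier L \<times> carrier L. \<zero>\<^bsub>A\<^esub>)"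
  by (simp_all add: Z2_def split_beta)

lemma
  assumes "c \<in> cocycles L A"
  shows cocycle_extensional: "fst c \<in> extensional (carrier L \<times> carrier L)"
      "snd c \<in> extensional (carrier L \<times> carrier L)"
    and cocycle_closed:
      "\<lbrakk>x \<in> carrier L; y \<in> carrier L\<rbrakk> \<Longrightarrow> fst c (x, y) \<in> carrier A"
      "\<lbrakk>x \<in> carrier L; y \<in> carrier L\<rbrakk> \<Longrightarrow> snd c (x, y) \<in> carrier A"
  using assms by (auto simp: cocycles_def PiE_def)

lemma
  assumes "c \<in> cocycles L A" "x \<in> carrier L" "y \<in> carrier L" "z \<in> carrier L"
  shows cocycle_bracket_add_left:
      "fst c (x \<oplus> y, z) = fst c (x, z) \<oplus>\<^bsub>A\<^esub> fst c (y, z) \<oplus>\<^bsub>A\<^esub> snd c (x \<otimes> z, y \<otimes> z)"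
    and cocycle_bracket_add_right:
      "fst c (x, y \<oplus> z) = fst c (x, y) \<oplus>\<^bsub>A\<^esub> fst c (x, z) \<oplus>\<^bsub>A\<^esub> snd c (x \<otimes> y, x \<otimes> z)"
    and cocycle_bracket_self: "fst c (x, x) = \<zero>\<^bsub>A\<^esub>"
    and cocycle_jacobi:
      "fst c (x, y \<otimes> z) \<oplus>\<^bsub>A\<^esub> fst c (z, x \<otimes> y) \<oplus>\<^bsub>A\<^esub> fst c (y, z \<otimes> x) =
        (\<ominus>\<^bsub>A\<^esub> snd c (x \<otimes> (y \<otimes> z), z \<otimes> (x \<otimes> y))) \<ominus>\<^bsub>A\<^esub> snd c (\<ominus> (y \<otimes> (z \<otimes> x)), y \<otimes> (z \<otimes> x))"
    and cocycle_add_assoc: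
      "snd c (x \<oplus> y, z) \<oplus>\<^bsub>A\<^esub> snd c (x, y) = snd c (x, y \<oplus> z) \<oplus>\<^bsub>A\<^esub> snd c (y, z)"
    and cocycle_add_sym: "snd c (x, y) = snd c (y, x)"
  using assms unfolding cocycles_def by (clarsimp simp only: mem_Collect_eq split_beta; metis)+

lemma cocycles_add:
  assumes c: "c \<in> cocycles L A" "c' \<in> cocycles L A"
  shows "(\<lambda>p \<in> carrier L \<times> carrier L. fst c p \<oplus>\<^bsub>A\<^esub> fst c' p,
    \<lambda>p \<in> carrier L \<times> carrier L. snd c p \<oplus>\<^bsub>A\<^esub> snd c' p) \<in> cocycles L A"
  unfolding cocycles_def mem_Collect_eq prod.case
proof (intro conjI ballI)
  fix x y z assume xyz: "x \<in> carrier L" "y \<in> carrier L" "z \<in> carrier L"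
  note cl = xyz bracket_closed a_closed a_inv_closed
  note [simp] = cl cocycle_closed[OF c(1)] cocycle_closed[OF c(2)]
  let ?f = "\<lambda>p \<in> carrier L \<times> carrier L. fst c p \<oplus>\<^bsub>A\<^esub> fst c' p"
  let ?g = "\<lambda>p \<in> carrier L \<times> carrier L. snd c p \<oplus>\<^bsub>A\<^esub> snd c' p"
  show "?f (x \<oplus> y, z) = ?f (x, z) \<oplus>\<^bsub>A\<^esub> ?f (y, z) \<oplus>\<^bsub>A\<^esub> ?g (x \<otimes> z, y \<otimes> z)"
    by (simp add: c cocycle_bracket_add_left A.a_ac)
  show "?f (x, y \<oplus> z) = ?f (x, y) \<oplus>\<^bsub>A\<^esub> ?f (x, z) \<oplus>\<^bsub>A\<^esub> ?g (x \<otimes> y, x \<otimes> z)"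
    by (simp add: c cocycle_bracket_add_right A.a_ac)
  show "?f (x, x) = \<zero>\<^bsub>A\<^esub>" "?g (x, y) = ?g (y, x)"
    using cocycle_add_sym[OF c(1) xyz] cocycle_add_sym[OF c(2) xyz]
    by (simp_all add: c cocycle_bracket_self[of _ x x x])
  \<comment> \<open>The terms are regrouped into the two cyclic sums, so that the Jacobi identity of
    each summand can be rewritten separately. The associativity identity below is treated in the
    same way.\<close>
  have "?f (x, y \<otimes> z) \<oplus>\<^bsub>A\<^esub> ?f (z, x \<otimes> y) \<oplus>\<^bsub>A\<^esub> ?f (y, z \<otimes> x) =
      (fst c (x, y \<otimes> z) \<oplus>\<^bsub>A\<^esub> fst c (z, x \<otimes> y) \<oplus>\<^bsub>A\<^esub> fst c (y, z \<otimes> x)) \<oplus>\<^bsub>A\<^esub>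
      (fst c' (x, y \<otimes> z) \<oplus>\<^bsub>A\<^esub> fst c' (z, x \<otimes> y) \<oplus>\<^bsub>A\<^esub> fst c' (y, z \<otimes> x))"
    by (simp add: A.a_ac)
  then show "?f (x, y \<otimes> z) \<oplus>\<^bsub>A\<^esub> ?f (z, x \<otimes> y) \<oplus>\<^bsub>A\<^esub> ?f (y, z \<otimes> x) =
      (\<ominus>\<^bsub>A\<^esub> ?g (x \<otimes> (y \<otimes> z), z \<otimes> (x \<otimes> y))) \<ominus>\<^bsub>A\<^esub> ?g (\<ominus> (y \<otimes> (z \<otimes> x)), y \<otimes> (z \<otimes> x))"
    unfolding cocycle_jacobi[OF c(1) xyz] cocycle_jacobi[OF c(2) xyz]
    by (simp add: A.minus_add A.minus_eq A.a_ac)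
  have "?g (x \<oplus> y, z) \<oplus>\<^bsub>A\<^esub> ?g (x, y) =
      (snd c (x \<oplus> y, z) \<oplus>\<^bsub>A\<^esub> snd c (x, y)) \<oplus>\<^bsub>A\<^esub> (snd c' (x \<oplus> y, z) \<oplus>\<^bsub>A\<^esub> snd c' (x, y))"
    by (simp add: A.a_ac)
  then show "?g (x \<oplus> y, z) \<oplus>\<^bsub>A\<^esub> ?g (x, y) = ?g (x, y \<oplus> z) \<oplus>\<^bsub>A\<^esub> ?g (y, z)"
    unfolding cocycle_add_assoc[OF c(1) xyz] cocycle_add_assoc[OF c(2) xyz]
    by (simp add: A.a_ac)
qed (auto simp: cocycle_closed[OF c(1)] cocycle_closed[OF c(2)])

lemma cocycles_minus:
  assumes c: "c \<in> cocycles L A"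
  shows "(\<lambda>p \<in> carrier L \<times> carrier L. \<ominus>\<^bsub>A\<^esub> fst c p,
    \<lambda>p \<in> carrier L \<times> carrier L. \<ominus>\<^bsub>A\<^esub> snd c p) \<in> cocycles L A"
  unfolding cocycles_def mem_Collect_eq prod.case
proof (intro conjI ballI)
  fix x y z assume xyz: "x \<in> carrier L" "y \<in> carrier L" "z \<in> carrier L"
  note cl = xyz bracket_closed a_closed a_inv_closed
  note [simp] = cl cocycle_closed[OF c]
  let ?f = "\<lambda>p \<in> carrier L \<times> carrier L. \<ominus>\<^bsub>A\<^esub> fst c p"
  let ?g = "\<lambda>p \<in> carrier L \<times> carrier L. \<ominus>\<^bsub>A\<^esub> snd c p"
  show "?f (x \<oplus> y, z) = ?f (x, z) \<oplus>\<^bsub>A\<^esub> ?f (y, z) \<oplus>\<^bsub>A\<^esub> ?g (x \<otimes> z, y \<otimes> z)"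
    by (simp add: c cocycle_bracket_add_left A.minus_add)
  show "?f (x, y \<oplus> z) = ?f (x, y) \<oplus>\<^bsub>A\<^esub> ?f (x, z) \<oplus>\<^bsub>A\<^esub> ?g (x \<otimes> y, x \<otimes> z)"
    by (simp add: c cocycle_bracket_add_right A.minus_add)
  show "?f (x, x) = \<zero>\<^bsub>A\<^esub>" "?g (x, y) = ?g (y, x)"
    using cocycle_add_sym[OF c xyz]
    by (simp_all add: c cocycle_bracket_self[of _ x x x] A.minus_zero)
  have "?f (x, y \<otimes> z) \<oplus>\<^bsub>A\<^esub> ?f (z, x \<otimes> y) \<oplus>\<^bsub>A\<^esub> ?f (y, z \<otimes> x) =
      \<ominus>\<^bsub>A\<^esub> (fst c (x, y \<otimes> z) \<oplus>\<^bsub>A\<^esub> fst c (z, x \<otimes> y) \<oplus>\<^bsub>A\<^esub> fst c (y, z \<otimes> x))"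
    by (simp add: A.minus_add)
  then show "?f (x, y \<otimes> z) \<oplus>\<^bsub>A\<^esub> ?f (z, x \<otimes> y) \<oplus>\<^bsub>A\<^esub> ?f (y, z \<otimes> x) =
      (\<ominus>\<^bsub>A\<^esub> ?g (x \<otimes> (y \<otimes> z), z \<otimes> (x \<otimes> y))) \<ominus>\<^bsub>A\<^esub> ?g (\<ominus> (y \<otimes> (z \<otimes> x)), y \<otimes> (z \<otimes> x))"
    unfolding cocycle_jacobi[OF c xyz]
    by (simp add: A.minus_add A.minus_eq)
  have "?g (x \<oplus> y, z) \<oplus>\<^bsub>A\<^esub> ?g (x, y) = \<ominus>\<^bsub>A\<^esub> (snd c (x \<oplus> y, z) \<oplus>\<^bsub>A\<^esub> snd c (x, y))"
    by (simp add: A.minus_add)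
  then show "?g (x \<oplus> y, z) \<oplus>\<^bsub>A\<^esub> ?g (x, y) = ?g (x, y \<oplus> z) \<oplus>\<^bsub>A\<^esub> ?g (y, z)"
    unfolding cocycle_add_assoc[OF c xyz]
    by (simp add: A.minus_add)
qed (auto simp: cocycle_closed[OF c])

lemma comm_group_Z2: "comm_group (Z2 L A)"
proof (rule comm_groupI; (unfold Z2_simps)?)
  fix c assume c: "c \<in> cocycles L A"
  note [simp] = cocycle_closed[OF c]
  show "(\<lambda>p\<in>carrier L \<times> carrier L. fst (\<lambda>p\<in>carrier L \<times> carrier L. \<zero>\<^bsub>A\<^esub>, \<lambda>p\<in>carrier L \<times> carrier L. \<zero>\<^bsub>A\<^esub>) p \<oplus>\<^bsub>A\<^esub> fst c p,
      \<lambda>p\<in>carrier L \<times> carrier L. snd (\<lambda>p\<in>carrier L \<times> carrier L. \<zero>\<^bsub>A\<^esub>, \<lambda>p\<in>carrier L \<times> carrier L. \<zero>\<^bsub>A\<^esub>) p \<oplus>\<^bsub>A\<^esub> snd c p) = c"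
    by (rule prod_eqI; rule extensionalityI[of _ "carrier L \<times> carrier L"])
      (auto simp: cocycle_extensional[OF c])
  show "\<exists>d\<in>cocycles L A. (\<lambda>p\<in>carrier L \<times> carrier L. fst d p \<oplus>\<^bsub>A\<^esub> fst c p,
      \<lambda>p\<in>carrier L \<times> carrier L. snd d p \<oplus>\<^bsub>A\<^esub> snd c p) =
      (\<lambda>p\<in>carrier L \<times> carrier L. \<zero>\<^bsub>A\<^esub>, \<lambda>p\<in>carrier L \<times> carrier L. \<zero>\<^bsub>A\<^esub>)"
    by (rule bexI[OF _ cocycles_minus[OF c]]) (auto simp: A.l_neg intro!: restrict_ext)
next
  fix c c' assume c: "c \<in> cocycles L A" "c' \<in> cocycles L A"
  show "(\<lambda>p\<in>carrier L \<times> carrier L. fst c p \<oplus>\<^bsub>A\<^esub> fst c' p,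
      \<lambda>p\<in>carrier L \<times> carrier L. snd c p \<oplus>\<^bsub>A\<^esub> snd c' p) =
      (\<lambda>p\<in>carrier L \<times> carrier L. fst c' p \<oplus>\<^bsub>A\<^esub> fst c p,
      \<lambda>p\<in>carrier L \<times> carrier L. snd c' p \<oplus>\<^bsub>A\<^esub> snd c p)"
    using c by (auto simp: cocycle_closed A.a_comm intro!: restrict_ext)
next
  show "(\<lambda>p\<in>carrier L \<times> carrier L. \<zero>\<^bsub>A\<^esub>, \<lambda>p\<in>carrier L \<times> carrier L. \<zero>\<^bsub>A\<^esub>) \<in> cocycles L A"
    by (auto simp: cocycles_def bracket_closed A.minus_eq A.minus_zero)
next
  fix c c' d assume c: "c \<in> cocycles L A" "c' \<in> cocycles L A" "d \<in> cocycles L A"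
  note [simp] = cocycle_closed[OF c(1)] cocycle_closed[OF c(2)] cocycle_closed[OF c(3)]
  show "(\<lambda>p\<in>carrier L \<times> carrier L. fst (\<lambda>p\<in>carrier L \<times> carrier L. fst c p \<oplus>\<^bsub>A\<^esub> fst c' p,
        \<lambda>p\<in>carrier L \<times> carrier L. snd c p \<oplus>\<^bsub>A\<^esub> snd c' p) p \<oplus>\<^bsub>A\<^esub> fst d p,
      \<lambda>p\<in>carrier L \<times> carrier L. snd (\<lambda>p\<in>carrier L \<times> carrier L. fst c p \<oplus>\<^bsub>A\<^esub> fst c' p,
        \<lambda>p\<in>carrier L \<times> carrier L. snd c p \<oplus>\<^bsub>A\<^esub> snd c' p) p \<oplus>\<^bsub>A\<^esub> snd d p) =
      (\<lambda>p\<in>carrier L \<times> carrier L. fst c p \<oplus>\<^bsub>A\<^esub> fst (\<lambda>p\<in>carrier L \<times> carrier L. fst c' p \<oplus>\<^bsub>A\<^esub> fst d p,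
        \<lambda>p\<in>carrier L \<times> carrier L. snd c' p \<oplus>\<^bsub>A\<^esub> snd d p) p,
      \<lambda>p\<in>carrier L \<times> carrier L. snd c p \<oplus>\<^bsub>A\<^esub> snd (\<lambda>p\<in>carrier L \<times> carrier L. fst c' p \<oplus>\<^bsub>A\<^esub> fst d p,
        \<lambda>p\<in>carrier L \<times> carrier L. snd c' p \<oplus>\<^bsub>A\<^esub> snd d p) p)"
    by (auto simp: A.a_assoc intro!: restrict_ext)
qed (simp_all add: cocycles_add)

end

section \<open>The defect of a map that is a homomorphism modulo a central ideal\<close>

context lie_ring_central_ideal
begin

text \<open>Negation is defined relative to the carrier of the record, so the two sides are
  different terms; they agree by uniqueness of inverses.\<close>

lemma minus_subring:
  assumes "h \<in> H" shows "\<ominus>\<^bsub>lie_subring L H\<^esub> h = \<ominus> h"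
proof -
  interpret K: lie_ring "lie_subring L H"
    by (rule lie_ring_subring)
  show ?thesis
    using K.minus_equality[of "\<ominus> h" h] assms by (simp add: l_neg)
qed

text \<open>Both the coboundaries (with \<open>H = L = A\<close> and \<open>\<chi> = id\<close>) and the transgression cocycles (with
  \<open>s\<close> a section of the projection) are of the following shape.\<close>

lemma defect_cocycle:
  fixes Q :: "('c, 'k) ring_scheme" and A :: "('d, 'n) ring_scheme"
  assumes "lie_ring Q" and "abelian_lie_ring A"
    and s: "s \<in> carrier Q \<rightarrow> carrier L" "s \<zero>\<^bsub>Q\<^esub> = \<zero>"
    and add_defect: "\<And>x y. \<lbrakk>x \<in> carrier Q; y \<in> carrier Q\<rbrakk> \<Longrightarrow> s x \<oplus> s y \<ominus> s (x \<oplus>\<^bsub>Q\<^esub> y) \<in> H"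
    and bracket_defect:
      "\<And>x y. \<lbrakk>x \<in> carrier Q; y \<in> carrier Q\<rbrakk> \<Longrightarrow> s x \<otimes> s y \<ominus> s (x \<otimes>\<^bsub>Q\<^esub> y) \<in> H"
    and \<chi>: "\<chi> \<in> lie_hom (lie_subring L H) A"
  shows "(\<lambda>(x, y) \<in> carrier Q \<times> carrier Q. \<chi> (s x \<otimes> s y \<ominus> s (x \<otimes>\<^bsub>Q\<^esub> y)),
    \<lambda>(x, y) \<in> carrier Q \<times> carrier Q. \<chi> (s x \<oplus> s y \<ominus> s (x \<oplus>\<^bsub>Q\<^esub> y))) \<in> cocycles Q A"
proof -
  interpret Q: lie_ring Q by fact
  interpret A: abelian_lie_ring A by fact
  interpret K: lie_trivial_coefficients "lie_subring L H" A
    by (intro lie_trivial_coefficients.intro lie_ring_subring \<open>abelian_lie_ring A\<close>)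
  define d where "d x y = s x \<otimes> s y \<ominus> s (x \<otimes>\<^bsub>Q\<^esub> y)" for x y
  define a where "a x y = s x \<oplus> s y \<ominus> s (x \<oplus>\<^bsub>Q\<^esub> y)" for x y
  have sc [simp]: "s x \<in> carrier L" if "x \<in> carrier Q" for x
    using s(1) that by auto
  have dH [simp]: "d x y \<in> H" and aH [simp]: "a x y \<in> H" if "x \<in> carrier Q" "y \<in> carrier Q" for x y
    using that by (simp_all add: d_def a_def add_defect bracket_defect)
  have \<chi>c [simp]: "\<chi> h \<in> carrier A" if "h \<in> H" for h
    using K.hom_closed[OF \<chi>] that by simp
  have \<chi>a: "\<chi> (h \<oplus> k) = \<chi> h \<oplus>\<^bsub>A\<^esub> \<chi> k" if "h \<in> H" "k \<in> H" for h k
    using K.hom_add[OF \<chi>] that by simp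
  have \<chi>m: "\<chi> (\<ominus> h) = \<ominus>\<^bsub>A\<^esub> \<chi> h" if "h \<in> H" for h
    using K.hom_minus[OF \<chi>] minus_subring that by simp
  have \<chi>0: "\<chi> \<zero> = \<zero>\<^bsub>A\<^esub>"
    using K.hom_zero[OF \<chi>] by simp
  \<comment> \<open>Inside a bracket \<open>s\<close> behaves like a homomorphism, because its
    defects lie in \<open>H\<close> and central elements drop out. The next two facts are the same
    for the second argument and for brackets.\<close>
  have add_left: "s (x \<oplus>\<^bsub>Q\<^esub> y) \<otimes> v = (s x \<oplus> s y) \<otimes> v"
    if "x \<in> carrier Q" "y \<in> carrier Q" "v \<in> carrier L" for x y v
  proof -
    have "(s x \<oplus> s y) \<otimes> v = s (x \<oplus>\<^bsub>Q\<^esub> y) \<otimes> v"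
      using that add_defect by (intro bracket_cong_central) (auto simp: minus_eq r_neg)
    then show ?thesis by simp
  qed
  have add_right: "v \<otimes> s (x \<oplus>\<^bsub>Q\<^esub> y) = v \<otimes> (s x \<oplus> s y)"
    if "x \<in> carrier Q" "y \<in> carrier Q" "v \<in> carrier L" for x y v
  proof -
    have "v \<otimes> (s x \<oplus> s y) = v \<otimes> s (x \<oplus>\<^bsub>Q\<^esub> y)"
      using that add_defect by (intro bracket_cong_central) (auto simp: minus_eq r_neg)
    then show ?thesis by simp
  qed
  have bracket_right': "v \<otimes> s (x \<otimes>\<^bsub>Q\<^esub> y) = v \<otimes> (s x \<otimes> s y)"
    if "x \<in> carrier Q" "y \<in> carrier Q" "v \<in> carrier L" for x y v
  proof -
    have "v \<otimes> (s x \<otimes> s y) = v \<otimes> s (x \<otimes>\<^bsub>Q\<^esub> y)"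
      using that bracket_defect
      by (intro bracket_cong_central) (auto simp: minus_eq r_neg bracket_closed Q.bracket_closed)
    then show ?thesis by simp
  qed
  have "(\<lambda>(x, y) \<in> carrier Q \<times> carrier Q. \<chi> (d x y),
      \<lambda>(x, y) \<in> carrier Q \<times> carrier Q. \<chi> (a x y)) \<in> cocycles Q A"
    unfolding cocycles_def mem_Collect_eq prod.case
  proof (intro conjI ballI)
    fix x y z assume xyz: "x \<in> carrier Q" "y \<in> carrier Q" "z \<in> carrier Q"
    note [simp] = xyz Q.bracket_closed bracket_closed
    let ?f = "\<lambda>(x, y) \<in> carrier Q \<times> carrier Q. \<chi> (d x y)"
    let ?g = "\<lambda>(x, y) \<in> carrier Q \<times> carrier Q. \<chi> (a x y)"
    have *: "s x \<in> carrier L" "s y \<in> carrier L" "s z \<in> carrier L"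
      "s (x \<otimes>\<^bsub>Q\<^esub> z) \<in> carrier L" "s (y \<otimes>\<^bsub>Q\<^esub> z) \<in> carrier L" "s (x \<otimes>\<^bsub>Q\<^esub> y) \<in> carrier L"
      "s (x \<otimes>\<^bsub>Q\<^esub> z \<oplus>\<^bsub>Q\<^esub> y \<otimes>\<^bsub>Q\<^esub> z) \<in> carrier L" "s (x \<otimes>\<^bsub>Q\<^esub> y \<oplus>\<^bsub>Q\<^esub> x \<otimes>\<^bsub>Q\<^esub> z) \<in> carrier L"
      "s (x \<oplus>\<^bsub>Q\<^esub> y) \<in> carrier L" "s (y \<oplus>\<^bsub>Q\<^esub> z) \<in> carrier L" "s (x \<oplus>\<^bsub>Q\<^esub> (y \<oplus>\<^bsub>Q\<^esub> z)) \<in> carrier L"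
      by simp_all
    \<comment> \<open>Once the bracket is expanded, the two sides differ only in having
      \<open>s\<close> of a sum in place of a sum of values of \<open>s\<close>; the term with
      \<open>a\<close> is exactly this difference.\<close>
    have "d (x \<oplus>\<^bsub>Q\<^esub> y) z = d x z \<oplus> d y z \<oplus> a (x \<otimes>\<^bsub>Q\<^esub> z) (y \<otimes>\<^bsub>Q\<^esub> z)"
      unfolding d_def a_def add_left[OF xyz(1,2) *(3)] Q.bracket_add_left[OF xyz]
      using * by algebra
    then show "?f (x \<oplus>\<^bsub>Q\<^esub> y, z) =
        ?f (x, z) \<oplus>\<^bsub>A\<^esub> ?f (y, z) \<oplus>\<^bsub>A\<^esub> ?g (x \<otimes>\<^bsub>Q\<^esub> z, y \<otimes>\<^bsub>Q\<^esub> z)"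
      by (simp add: \<chi>a)
    have "d x (y \<oplus>\<^bsub>Q\<^esub> z) = d x y \<oplus> d x z \<oplus> a (x \<otimes>\<^bsub>Q\<^esub> y) (x \<otimes>\<^bsub>Q\<^esub> z)"
      unfolding d_def a_def add_right[OF xyz(2,3) *(1)] Q.bracket_add_right[OF xyz]
      using * by algebra
    then show "?f (x, y \<oplus>\<^bsub>Q\<^esub> z) =
        ?f (x, y) \<oplus>\<^bsub>A\<^esub> ?f (x, z) \<oplus>\<^bsub>A\<^esub> ?g (x \<otimes>\<^bsub>Q\<^esub> y, x \<otimes>\<^bsub>Q\<^esub> z)"
      by (simp add: \<chi>a)
    show "?f (x, x) = \<zero>\<^bsub>A\<^esub>"
      by (simp add: d_def Q.bracket_self bracket_self s(2) minus_eq minus_zero \<chi>0)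
    \<comment> \<open>Both sides reduce to s x + s y + s z - s (x + y + z).\<close>
    have "a (x \<oplus>\<^bsub>Q\<^esub> y) z \<oplus> a x y = a x (y \<oplus>\<^bsub>Q\<^esub> z) \<oplus> a y z"
      unfolding a_def Q.a_assoc[OF xyz] using * by algebra
    then have "\<chi> (a (x \<oplus>\<^bsub>Q\<^esub> y) z) \<oplus>\<^bsub>A\<^esub> \<chi> (a x y) = \<chi> (a x (y \<oplus>\<^bsub>Q\<^esub> z)) \<oplus>\<^bsub>A\<^esub> \<chi> (a y z)"
      by (simp flip: \<chi>a)
    then show "?g (x \<oplus>\<^bsub>Q\<^esub> y, z) \<oplus>\<^bsub>A\<^esub> ?g (x, y) = ?g (x, y \<oplus>\<^bsub>Q\<^esub> z) \<oplus>\<^bsub>A\<^esub> ?g (y, z)"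
      by simp
    show "?g (x, y) = ?g (y, x)"
      by (simp add: a_def a_comm Q.a_comm)
    \<comment> \<open>The Jacobi identity in \<open>Q\<close> says u + w = -v. This is the source of
      the argument -[y, [z, x]] in the cocycle identity: it stands for the sum of the other two
      terms.\<close>
    define u v w where "u = x \<otimes>\<^bsub>Q\<^esub> (y \<otimes>\<^bsub>Q\<^esub> z)" and "v = y \<otimes>\<^bsub>Q\<^esub> (z \<otimes>\<^bsub>Q\<^esub> x)" and "w = z \<otimes>\<^bsub>Q\<^esub> (x \<otimes>\<^bsub>Q\<^esub> y)"
    have uvw [simp]: "u \<in> carrier Q" "v \<in> carrier Q" "w \<in> carrier Q"
      by (simp_all add: u_def v_def w_def)
    have "u \<oplus>\<^bsub>Q\<^esub> w \<oplus>\<^bsub>Q\<^esub> v = \<zero>\<^bsub>Q\<^esub>"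
      using Q.jacobi[OF xyz] by (simp add: u_def v_def w_def Q.a_ac)
    then have uw: "u \<oplus>\<^bsub>Q\<^esub> w = \<ominus>\<^bsub>Q\<^esub> v"
      using Q.minus_equality[of "u \<oplus>\<^bsub>Q\<^esub> w" v] by simp
    have s3: "s u \<in> carrier L" "s v \<in> carrier L" "s w \<in> carrier L" "s (\<ominus>\<^bsub>Q\<^esub> v) \<in> carrier L"
      "s x \<otimes> (s y \<otimes> s z) \<in> carrier L" "s y \<otimes> (s z \<otimes> s x) \<in> carrier L" "s z \<otimes> (s x \<otimes> s y) \<in> carrier L"
      by simp_all
    have "d x (y \<otimes>\<^bsub>Q\<^esub> z) \<oplus> d z (x \<otimes>\<^bsub>Q\<^esub> y) \<oplus> d y (z \<otimes>\<^bsub>Q\<^esub> x) =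
        (s x \<otimes> (s y \<otimes> s z) \<oplus> s y \<otimes> (s z \<otimes> s x) \<oplus> s z \<otimes> (s x \<otimes> s y)) \<ominus> (s u \<oplus> s v \<oplus> s w)"
      unfolding d_def bracket_right'[OF xyz(2,3) *(1)] bracket_right'[OF xyz(3,1) *(2)]
        bracket_right'[OF xyz(1,2) *(3)] u_def[symmetric] v_def[symmetric] w_def[symmetric]
      using s3 by (simp add: minus_eq minus_add a_ac)
    also have "\<dots> = \<zero> \<ominus> (s u \<oplus> s v \<oplus> s w)"
      using * by (simp add: jacobi)
    \<comment> \<open>Inserting s (-v) splits the sum into two addition defects, first adding u and
      w to get -v, then adding -v and v to get 0. The second one is a defect because s 0 =
      0.\<close>
    also have "\<dots> = \<ominus> (s u \<oplus> s w \<ominus> s (\<ominus>\<^bsub>Q\<^esub> v)) \<oplus> \<ominus> (s (\<ominus>\<^bsub>Q\<^esub> v) \<oplus> s v \<ominus> \<zero>)"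
      using s3(1-4) by algebra
    also have "\<dots> = \<ominus> a u w \<oplus> \<ominus> a (\<ominus>\<^bsub>Q\<^esub> v) v"
      by (simp add: a_def uw Q.l_neg s(2))
    finally have "\<chi> (d x (y \<otimes>\<^bsub>Q\<^esub> z) \<oplus> d z (x \<otimes>\<^bsub>Q\<^esub> y) \<oplus> d y (z \<otimes>\<^bsub>Q\<^esub> x)) =
        \<chi> (\<ominus> a u w \<oplus> \<ominus> a (\<ominus>\<^bsub>Q\<^esub> v) v)"
      by simp
    then show "?f (x, y \<otimes>\<^bsub>Q\<^esub> z) \<oplus>\<^bsub>A\<^esub> ?f (z, x \<otimes>\<^bsub>Q\<^esub> y) \<oplus>\<^bsub>A\<^esub> ?f (y, z \<otimes>\<^bsub>Q\<^esub> x) =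
        (\<ominus>\<^bsub>A\<^esub> ?g (x \<otimes>\<^bsub>Q\<^esub> (y \<otimes>\<^bsub>Q\<^esub> z), z \<otimes>\<^bsub>Q\<^esub> (x \<otimes>\<^bsub>Q\<^esub> y)))
          \<ominus>\<^bsub>A\<^esub> ?g (\<ominus>\<^bsub>Q\<^esub> (y \<otimes>\<^bsub>Q\<^esub> (z \<otimes>\<^bsub>Q\<^esub> x)), y \<otimes>\<^bsub>Q\<^esub> (z \<otimes>\<^bsub>Q\<^esub> x))"
      unfolding u_def[symmetric] v_def[symmetric] w_def[symmetric]
      by (simp add: \<chi>a \<chi>m A.minus_eq)
  qed auto
  then show ?thesis
    unfolding d_def a_def .
qed

end

text \<open>With \<open>A\<close> as its own central ideal, every map into \<open>A\<close> has its
  defects in the ideal, so \<open>defect_cocycle\<close> applies to an arbitrary map that preserves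
  zero.\<close>

lemma (in abelian_lie_ring) central_ideal_carrier: "lie_ring_central_ideal (carrier L) L"
  by (intro lie_ring_central_ideal.intro central_lie_ideal.intro lie_ideal.intro
      central_lie_ideal_axioms.intro lie_ideal_axioms.intro lie_ring_axioms additive_subgroupI
      add.subgroup_self)
    (auto simp: lie_center_def bracket_zero)

section \<open>Coboundaries and second cohomology\<close>

context lie_trivial_coefficients
begin

text \<open>A coboundary is the defect pair of t as a map from \<open>L\<close> to \<open>A\<close>:
  the bracket of \<open>A\<close> vanishes, so the bracket defect [t x, t y] - t [x, y] is just -t
  [x, y].\<close>

lemma coboundary_cocycle:
  assumes t: "t \<in> carrier L \<rightarrow> carrier A" "t \<zero> = \<zero>\<^bsub>A\<^esub>"
  shows "coboundary L A t \<in> cocycles L A"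
proof -
  interpret AA: lie_ring_central_ideal "carrier A" A
    by (rule A.central_ideal_carrier)
  have tc [simp]: "t x \<in> carrier A" if "x \<in> carrier L" for x
    using t(1) that by auto
  \<comment> \<open>The identity has to be restricted because members of \<open>lie_hom\<close> are
    extensional.\<close>
  have id: "restrict id (carrier A) \<in> lie_hom (lie_subring A (carrier A)) A"
    by (auto simp: lie_hom_def A.bracket_closed)
  have "(\<lambda>(x, y) \<in> carrier L \<times> carrier L. restrict id (carrier A) (t x \<otimes>\<^bsub>A\<^esub> t y \<ominus>\<^bsub>A\<^esub> t (x \<otimes> y)),
      \<lambda>(x, y) \<in> carrier L \<times> carrier L. restrict id (carrier A) (t x \<oplus>\<^bsub>A\<^esub> t y \<ominus>\<^bsub>A\<^esub> t (x \<oplus> y)))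
      \<in> cocycles L A"
    by (intro AA.defect_cocycle[OF lie_ring_axioms A.abelian_lie_ring_axioms t _ _ id])
      (auto simp: bracket_closed A.bracket_closed)
  also have "(\<lambda>(x, y) \<in> carrier L \<times> carrier L. restrict id (carrier A) (t x \<otimes>\<^bsub>A\<^esub> t y \<ominus>\<^bsub>A\<^esub> t (x \<otimes> y)),
      \<lambda>(x, y) \<in> carrier L \<times> carrier L. restrict id (carrier A) (t x \<oplus>\<^bsub>A\<^esub> t y \<ominus>\<^bsub>A\<^esub> t (x \<oplus> y))) =
      coboundary L A t"
    by (auto simp: coboundary_def A.bracket_zero A.minus_eq bracket_closed intro!: restrict_ext)
  finally show ?thesis .
qed

lemma coboundary_mult:
  assumes "t \<in> carrier L \<rightarrow> carrier A" "t' \<in> carrier L \<rightarrow> carrier A"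
  shows "coboundary L A t \<otimes>\<^bsub>Z2 L A\<^esub> coboundary L A t' = coboundary L A (\<lambda>x. t x \<oplus>\<^bsub>A\<^esub> t' x)"
proof -
  have tc [simp]: "t x \<in> carrier A" "t' x \<in> carrier A" if "x \<in> carrier L" for x
    using assms that by auto
  show ?thesis
    by (auto simp: coboundary_def Z2_simps bracket_closed A.minus_add A.minus_eq A.a_ac
        intro!: restrict_ext)
qed

lemma coboundary_zero: "coboundary L A (\<lambda>_. \<zero>\<^bsub>A\<^esub>) = \<one>\<^bsub>Z2 L A\<^esub>"
  by (auto simp: coboundary_def Z2_simps A.minus_zero A.minus_eq)

lemma subgroup_B2: "subgroup (B2 L A) (Z2 L A)"
proof -
  interpret Z: comm_group "Z2 L A"
    by (rule comm_group_Z2)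
  show ?thesis
  proof (rule Z.subgroupI)
    show "B2 L A \<subseteq> carrier (Z2 L A)"
      by (auto simp: B2_def Z2_simps coboundary_cocycle)
    have "coboundary L A (\<lambda>_. \<zero>\<^bsub>A\<^esub>) \<in> B2 L A"
      by (auto simp: B2_def)
    then show "B2 L A \<noteq> {}"
      by blast
  next
    fix c assume "c \<in> B2 L A"
    then obtain t where c: "c = coboundary L A t" and t: "t \<in> carrier L \<rightarrow> carrier A" "t \<zero> = \<zero>\<^bsub>A\<^esub>"
      by (auto simp: B2_def)
    have t': "(\<lambda>x. \<ominus>\<^bsub>A\<^esub> t x) \<in> carrier L \<rightarrow> carrier A" "\<ominus>\<^bsub>A\<^esub> t \<zero> = \<zero>\<^bsub>A\<^esub>"
      using t by (auto simp: A.minus_zero)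
    have "coboundary L A (\<lambda>x. \<ominus>\<^bsub>A\<^esub> t x) \<otimes>\<^bsub>Z2 L A\<^esub> c = coboundary L A (\<lambda>x. \<ominus>\<^bsub>A\<^esub> t x \<oplus>\<^bsub>A\<^esub> t x)"
      unfolding c by (rule coboundary_mult[OF t'(1) t(1)])
    also have "\<dots> = coboundary L A (\<lambda>_. \<zero>\<^bsub>A\<^esub>)"
      using t(1) by (auto simp: coboundary_def A.l_neg bracket_closed PiE_def Pi_iff intro!: restrict_ext)
    finally have "inv\<^bsub>Z2 L A\<^esub> c = coboundary L A (\<lambda>x. \<ominus>\<^bsub>A\<^esub> t x)"
      unfolding coboundary_zero
      by (rule Z.inv_equality) (use t t' in \<open>simp_all add: c Z2_simps coboundary_cocycle\<close>)
    then show "inv\<^bsub>Z2 L A\<^esub> c \<in> B2 L A"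
      using t' by (auto simp: B2_def)
  next
    fix c c' assume "c \<in> B2 L A" "c' \<in> B2 L A"
    then obtain t t' where c: "c = coboundary L A t" "c' = coboundary L A t'"
      and t: "t \<in> carrier L \<rightarrow> carrier A" "t \<zero> = \<zero>\<^bsub>A\<^esub>" "t' \<in> carrier L \<rightarrow> carrier A" "t' \<zero> = \<zero>\<^bsub>A\<^esub>"
      by (auto simp: B2_def)
    have "(\<lambda>x. t x \<oplus>\<^bsub>A\<^esub> t' x) \<in> carrier L \<rightarrow> carrier A" "t \<zero> \<oplus>\<^bsub>A\<^esub> t' \<zero> = \<zero>\<^bsub>A\<^esub>"
      using t by auto
    then show "c \<otimes>\<^bsub>Z2 L A\<^esub> c' \<in> B2 L A"
      unfolding c coboundary_mult[OF t(1,3)] B2_def by blast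
  qed
qed

sublocale Z: comm_group "Z2 L A"
  by (rule comm_group_Z2)

lemma normal_B2: "B2 L A \<lhd> Z2 L A"
  by (rule Z.subgroup_imp_normal[OF subgroup_B2])

lemma comm_group_H2: "comm_group (H2 L A)"
  unfolding H2_def by (rule Z.abelian_FactGroup[OF subgroup_B2])

lemma H2_class_hom: "H2_class L A \<in> hom (Z2 L A) (H2 L A)"
  unfolding H2_def H2_class_def by (rule normal.r_coset_hom_Mod[OF normal_B2])

lemma carrier_H2: "carrier (H2 L A) = H2_class L A ` cocycles L A"
  unfolding H2_def H2_class_def carrier_FactGroup Z2_simps ..

lemma H2_class_eq_one_iff:
  assumes "c \<in> cocycles L A"
  shows "H2_class L A c = \<one>\<^bsub>H2 L A\<^esub> \<longleftrightarrow> c \<in> B2 L A"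
  using Z.coset_join1[of "B2 L A" c] Z.coset_join2[of c "B2 L A"] subgroup_B2 assms
  by (auto simp only: H2_class_def H2_def Z2_simps one_FactGroup)

text \<open>The form in which representatives are changed later: a class is recognised as a
  transgression after correction by a coboundary.\<close>

lemma H2_class_mult_coboundary:
  assumes c: "c \<in> cocycles L A" and t: "t \<in> carrier L \<rightarrow> carrier A" "t \<zero> = \<zero>\<^bsub>A\<^esub>"
  shows "H2_class L A (coboundary L A t \<otimes>\<^bsub>Z2 L A\<^esub> c) = H2_class L A c"
proof -
  have "coboundary L A t \<in> B2 L A"
    using t by (auto simp: B2_def)
  then have "coboundary L A t \<otimes>\<^bsub>Z2 L A\<^esub> c \<in> B2 L A #>\<^bsub>Z2 L A\<^esub> c"
    by (auto simp: r_coset_def)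
  then show ?thesis
    using Z.repr_independence[OF _ _ subgroup_B2] c by (simp add: H2_class_def Z2_simps)
qed

end

text \<open>Multiplying x by n in \<open>N\<close> multiplies its image by an element of
  \<open>M\<close>, so all cosets in the union coincide. It turns the union in \<open>Inf_H2\<close>
  into the class of one inflated representative.\<close>

lemma (in group_hom) induced_coset_map:
  assumes N: "subgroup N G" and M: "subgroup M H" and NM: "h ` N \<subseteq> M" and x: "x \<in> carrier G"
  shows "(\<Union>c \<in> N #> x. M #>\<^bsub>H\<^esub> h c) = M #>\<^bsub>H\<^esub> h x"
proof -
  have "M #>\<^bsub>H\<^esub> h c = M #>\<^bsub>H\<^esub> h x" if c: "c \<in> N #> x" for c
  proof -
    obtain n where n: "n \<in> N" "c = n \<otimes> x"
      using c by (auto simp: r_coset_def)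
    have "h c \<in> M #>\<^bsub>H\<^esub> h x"
      using n N NM x by (auto simp: r_coset_def subgroup.mem_carrier)
    then show ?thesis
      using H.repr_independence[OF _ _ M] x by simp
  qed
  then show ?thesis
    using G.rcos_self[OF x N] by blast
qed

text \<open>The last two premises are the two inclusions between image and kernel, put elementwise
  so that each exactness proof amounts to one computation and one choice of a preimage.\<close>

lemma exact_atI:
  assumes "group F" "group G" "group K" "u \<in> hom F G" "v \<in> hom G K"
    and "\<And>x. x \<in> carrier F \<Longrightarrow> v (u x) = \<one>\<^bsub>K\<^esub>"
    and "\<And>y. \<lbrakk>y \<in> carrier G; v y = \<one>\<^bsub>K\<^esub>\<rbrakk> \<Longrightarrow> \<exists>x \<in> carrier F. u x = y"
  shows "exact_at F u G v K"
  using assms hom_in_carrier[OF assms(4)]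
  by (force simp: exact_at_def group_hom_def group_hom_axioms_def kernel_def)

section \<open>Central extensions with a section, and transgression\<close>

locale lie_central_extension = lie_ring_central_ideal H L + lie_trivial_coefficients L A
  for H and L :: "('a, 'm) ring_scheme" (structure) and A :: "('b, 'n) ring_scheme" +
  fixes l
  assumes is_section: "lie_section L H l"
begin

sublocale Q: lie_trivial_coefficients "L Quot H" A
  by (intro lie_trivial_coefficients.intro lie_ring_Quot A.abelian_lie_ring_axioms)

sublocale K: lie_trivial_coefficients "lie_subring L H" A
  by (intro lie_trivial_coefficients.intro lie_ring_subring A.abelian_lie_ring_axioms)

lemma section_funcset: "l \<in> carrier (L Quot H) \<rightarrow> carrier L"
  and rcos_section: "u \<in> carrier (L Quot H) \<Longrightarrow> H +> l u = u"
  and section_zero: "l \<zero>\<^bsub>L Quot H\<^esub> = \<zero>"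
  using is_section by (auto simp: lie_section_def)

lemma section_closed: "u \<in> carrier (L Quot H) \<Longrightarrow> l u \<in> carrier L"
  using section_funcset by auto

lemma section_rcos_diff:
  assumes "x \<in> carrier L" shows "l (H +> x) \<ominus> x \<in> H"
  using assms by (simp flip: rcos_eq_iff add: rcos_section section_closed rcos_closed)

lemma section_add_mem:
  assumes "u \<in> carrier (L Quot H)" "v \<in> carrier (L Quot H)"
  shows "l u \<oplus> l v \<ominus> l (u \<oplus>\<^bsub>L Quot H\<^esub> v) \<in> H"
  using assms
  by (simp flip: rcos_eq_iff add_Quot add: rcos_section section_closed)

lemma section_bracket_mem:
  assumes "u \<in> carrier (L Quot H)" "v \<in> carrier (L Quot H)"
  shows "l u \<otimes> l v \<ominus> l (u \<otimes>\<^bsub>L Quot H\<^esub> v) \<in> H"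
  using assms
  by (simp flip: rcos_eq_iff bracket_Quot
      add: rcos_section section_closed bracket_closed Q.bracket_closed)

lemma minus_Quot: "x \<in> carrier L \<Longrightarrow> \<ominus>\<^bsub>L Quot H\<^esub> (H +> x) = H +> \<ominus> x"
  by (rule Q.minus_equality) (simp_all add: add_Quot rcos_closed l_neg zero_Quot)

text \<open>The representative of \<open>Tra\<close> before passing to classes; it is already
  additive in \<chi>, so \<open>Tra\<close> is a composite of two homomorphisms.\<close>

definition tra_cocycle where
  "tra_cocycle \<chi> =
    (\<lambda>p \<in> carrier (L Quot H) \<times> carrier (L Quot H). \<chi> (section_bracket L H l p),
     \<lambda>p \<in> carrier (L Quot H) \<times> carrier (L Quot H). \<chi> (section_add L H l p))"

lemma Tra_eq: "Tra L H A l \<chi> = H2_class (L Quot H) A (tra_cocycle \<chi>)"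
  by (simp add: Tra_def tra_cocycle_def)

lemma tra_cocycle_closed:
  assumes "\<chi> \<in> lie_hom (lie_subring L H) A"
  shows "tra_cocycle \<chi> \<in> cocycles (L Quot H) A"
proof -
  have "tra_cocycle \<chi> =
    (\<lambda>(u, v) \<in> carrier (L Quot H) \<times> carrier (L Quot H). \<chi> (l u \<otimes> l v \<ominus> l (u \<otimes>\<^bsub>L Quot H\<^esub> v)),
     \<lambda>(u, v) \<in> carrier (L Quot H) \<times> carrier (L Quot H). \<chi> (l u \<oplus> l v \<ominus> l (u \<oplus>\<^bsub>L Quot H\<^esub> v)))"
    by (auto simp: tra_cocycle_def section_bracket_def section_add_def intro!: restrict_ext)
  then show ?thesis
    using defect_cocycle[OF lie_ring_Quot A.abelian_lie_ring_axioms section_funcset section_zero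
        section_add_mem section_bracket_mem assms] by simp
qed

lemma tra_cocycle_hom: "tra_cocycle \<in> hom (lie_Hom (lie_subring L H) A) (Z2 (L Quot H) A)"
proof (rule homI; unfold K.lie_Hom_simps Q.Z2_simps)
  fix \<chi> \<psi>
  show "tra_cocycle (\<lambda>x \<in> carrier (lie_subring L H). \<chi> x \<oplus>\<^bsub>A\<^esub> \<psi> x) =
      (\<lambda>p \<in> carrier (L Quot H) \<times> carrier (L Quot H).
        fst (tra_cocycle \<chi>) p \<oplus>\<^bsub>A\<^esub> fst (tra_cocycle \<psi>) p,
       \<lambda>p \<in> carrier (L Quot H) \<times> carrier (L Quot H).
        snd (tra_cocycle \<chi>) p \<oplus>\<^bsub>A\<^esub> snd (tra_cocycle \<psi>) p)"
    by (auto simp: tra_cocycle_def section_bracket_def section_add_def section_add_mem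
        section_bracket_mem intro!: restrict_ext)
qed (rule tra_cocycle_closed)

lemma Tra_hom: "Tra L H A l \<in> hom (lie_Hom (lie_subring L H) A) (H2 (L Quot H) A)"
  using Group.hom_compose[OF tra_cocycle_hom Q.H2_class_hom] by (simp add: comp_def flip: Tra_eq)

section \<open>Inflation and restriction of homomorphisms; exactness at Hom(L, A)\<close>

lemma Inf_Hom_hom: "Inf_Hom L H \<in> hom (lie_Hom (L Quot H) A) (lie_Hom L A)"
proof (rule homI; unfold lie_Hom_simps Q.lie_Hom_simps)
  fix \<alpha> assume \<alpha>: "\<alpha> \<in> lie_hom (L Quot H) A"
  show "Inf_Hom L H \<alpha> \<in> lie_hom L A"
    using Q.hom_add[OF \<alpha>] Q.hom_bracket[OF \<alpha>]
    by (auto simp: lie_hom_iff Inf_Hom_def bracket_closed rcos_closed Q.hom_closed[OF \<alpha>]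
        simp flip: add_Quot bracket_Quot)
qed (auto simp: Inf_Hom_def rcos_closed intro!: restrict_ext)

text \<open>Every coset u is the image of \<open>l u\<close>, so the value of \<alpha> at u can be
  read off from the inflated map at \<open>l u\<close>.\<close>

lemma Inf_Hom_eq_one:
  assumes "\<alpha> \<in> lie_hom (L Quot H) A" "Inf_Hom L H \<alpha> = \<one>\<^bsub>lie_Hom L A\<^esub>"
  shows "\<alpha> = \<one>\<^bsub>lie_Hom (L Quot H) A\<^esub>"
proof (rule extensionalityI[of _ "carrier (L Quot H)"])
  fix u assume "u \<in> carrier (L Quot H)"
  then show "\<alpha> u = \<one>\<^bsub>lie_Hom (L Quot H) A\<^esub> u"
    using fun_cong[OF assms(2), of "l u"]
    by (simp add: Inf_Hom_def lie_Hom_simps Q.lie_Hom_simps section_closed rcos_section)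
qed (use assms in \<open>auto simp: lie_hom_def PiE_def Q.lie_Hom_simps\<close>)

lemma Res_Hom_hom: "Res_Hom H \<in> hom (lie_Hom L A) (lie_Hom (lie_subring L H) A)"
proof (rule homI; unfold lie_Hom_simps K.lie_Hom_simps)
  fix \<beta> assume \<beta>: "\<beta> \<in> lie_hom L A"
  show "Res_Hom H \<beta> \<in> lie_hom (lie_subring L H) A"
    using hom_add[OF \<beta>] hom_bracket[OF \<beta>] hom_closed[OF \<beta>] bracket_left
    by (auto simp: K.lie_hom_iff Res_Hom_def)
qed (auto simp: Res_Hom_def intro!: restrict_ext)

lemma hom_eq_if_diff_mem:
  assumes "\<beta> \<in> lie_hom L A" "\<And>h. h \<in> H \<Longrightarrow> \<beta> h = \<zero>\<^bsub>A\<^esub>" "x \<in> carrier L" "y \<in> carrier L" "x \<ominus> y \<in> H"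
  shows "\<beta> x = \<beta> y"
proof -
  have "x = (x \<ominus> y) \<oplus> y"
    using assms(3,4) by algebra
  then have "\<beta> x = \<beta> (x \<ominus> y) \<oplus>\<^bsub>A\<^esub> \<beta> y"
    using hom_add[OF assms(1), of "x \<ominus> y" y] assms(3,4) by simp
  then show ?thesis
    using assms hom_closed[OF assms(1)] by simp
qed

lemma exact_at_Hom:
  "exact_at (lie_Hom (L Quot H) A) (Inf_Hom L H) (lie_Hom L A) (Res_Hom H) (lie_Hom (lie_subring L H) A)"
proof (rule exact_atI)
  fix \<alpha> assume "\<alpha> \<in> carrier (lie_Hom (L Quot H) A)"
  then have \<alpha>: "\<alpha> \<in> lie_hom (L Quot H) A"
    by (simp add: Q.lie_Hom_simps)
  have "H +> h = \<zero>\<^bsub>L Quot H\<^esub>" if "h \<in> H" for h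
    using that a_rcos_const by (simp add: FactRing_def)
  then show "Res_Hom H (Inf_Hom L H \<alpha>) = \<one>\<^bsub>lie_Hom (lie_subring L H) A\<^esub>"
    by (auto simp: Res_Hom_def Inf_Hom_def K.lie_Hom_simps Q.hom_zero[OF \<alpha>] intro!: restrict_ext)
next
  fix \<beta> assume "\<beta> \<in> carrier (lie_Hom L A)" and 1: "Res_Hom H \<beta> = \<one>\<^bsub>lie_Hom (lie_subring L H) A\<^esub>"
  then have \<beta>: "\<beta> \<in> lie_hom L A"
    by (simp add: lie_Hom_simps)
  have \<beta>H: "\<beta> h = \<zero>\<^bsub>A\<^esub>" if "h \<in> H" for h
    using fun_cong[OF 1, of h] that by (simp add: Res_Hom_def K.lie_Hom_simps)
  have eq: "\<beta> x = \<beta> y" if "x \<in> carrier L" "y \<in> carrier L" "x \<ominus> y \<in> H" for x y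
    by (rule hom_eq_if_diff_mem[OF \<beta>]) (use that \<beta>H in auto)
  \<comment> \<open>The factorisation of \<beta> through the quotient, evaluated on chosen
    representatives. It is additive and kills brackets because the defects of \<open>l\<close> lie
    in \<open>H\<close>, where \<beta> vanishes.\<close>
  define \<alpha> where "\<alpha> = (\<lambda>u \<in> carrier (L Quot H). \<beta> (l u))"
  have "\<alpha> \<in> lie_hom (L Quot H) A"
    unfolding Q.lie_hom_iff
  proof (intro conjI ballI)
    fix u v assume uv: "u \<in> carrier (L Quot H)" "v \<in> carrier (L Quot H)"
    show "\<alpha> (u \<oplus>\<^bsub>L Quot H\<^esub> v) = \<alpha> u \<oplus>\<^bsub>A\<^esub> \<alpha> v"
      using eq[OF _ _ section_add_mem[OF uv]] uv hom_add[OF \<beta>]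
      by (simp add: \<alpha>_def section_closed)
    show "\<alpha> (u \<otimes>\<^bsub>L Quot H\<^esub> v) = \<zero>\<^bsub>A\<^esub>"
      using eq[OF _ _ section_bracket_mem[OF uv]] uv hom_bracket[OF \<beta>]
      by (simp add: \<alpha>_def section_closed bracket_closed Q.bracket_closed)
  qed (auto simp: \<alpha>_def section_closed hom_closed[OF \<beta>])
  moreover have "Inf_Hom L H \<alpha> = \<beta>"
  proof (rule extensionalityI[of _ "carrier L"])
    fix x assume "x \<in> carrier L"
    then show "Inf_Hom L H \<alpha> x = \<beta> x"
      using eq[OF _ _ section_rcos_diff] by (simp add: Inf_Hom_def \<alpha>_def rcos_closed section_closed)
  qed (use \<beta> in \<open>auto simp: Inf_Hom_def lie_hom_def PiE_def\<close>)
  ultimately show "\<exists>\<alpha> \<in> carrier (lie_Hom (L Quot H) A). Inf_Hom L H \<alpha> = \<beta>"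
    by (auto simp: Q.lie_Hom_simps)
qed (simp_all add: comm_group_lie_Hom Q.comm_group_lie_Hom
    K.comm_group_lie_Hom Inf_Hom_hom Res_Hom_hom comm_group.axioms(2))

section \<open>Exactness at Hom(H, A)\<close>

lemma exact_at_Hom_subring:
  "exact_at (lie_Hom L A) (Res_Hom H) (lie_Hom (lie_subring L H) A) (Tra L H A l) (H2 (L Quot H) A)"
proof (rule exact_atI)
  fix \<beta> assume "\<beta> \<in> carrier (lie_Hom L A)"
  then have \<beta>: "\<beta> \<in> lie_hom L A"
    by (simp add: lie_Hom_simps)
  have Res: "Res_Hom H \<beta> \<in> lie_hom (lie_subring L H) A"
    using hom_in_carrier[OF Res_Hom_hom] \<beta> by (simp add: lie_Hom_simps K.lie_Hom_simps)
  \<comment> \<open>The restriction of \<beta> sees only whole defects, but \<beta> is defined on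
    all of \<open>L\<close> and can be applied to each of their terms. Since \<beta> kills
    [l u, l v], what results is the coboundary of this map.\<close>
  let ?t = "\<lambda>u. \<beta> (l u)"
  have diff: "\<beta> (x \<ominus> y) = \<beta> x \<ominus>\<^bsub>A\<^esub> \<beta> y" if "x \<in> carrier L" "y \<in> carrier L" for x y
    using that by (simp add: minus_eq A.minus_eq hom_add[OF \<beta>] hom_minus[OF \<beta>])
  have "tra_cocycle (Res_Hom H \<beta>) = coboundary (L Quot H) A ?t"
    unfolding tra_cocycle_def coboundary_def prod.inject
    by (intro conjI restrict_ext)
      (auto simp: section_bracket_def section_add_def Res_Hom_def section_add_mem
        section_bracket_mem diff section_closed bracket_closed Q.bracket_closed hom_bracket[OF \<beta>]
        hom_add[OF \<beta>] hom_closed[OF \<beta>] A.minus_eq)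
  moreover have "coboundary (L Quot H) A ?t \<in> B2 (L Quot H) A"
    using hom_closed[OF \<beta>] by (auto simp: B2_def section_closed section_zero hom_zero[OF \<beta>])
  ultimately show "Tra L H A l (Res_Hom H \<beta>) = \<one>\<^bsub>H2 (L Quot H) A\<^esub>"
    unfolding Tra_eq Q.H2_class_eq_one_iff[OF tra_cocycle_closed[OF Res]] by simp
next
  fix \<chi> assume "\<chi> \<in> carrier (lie_Hom (lie_subring L H) A)" and 1: "Tra L H A l \<chi> = \<one>\<^bsub>H2 (L Quot H) A\<^esub>"
  then have \<chi>: "\<chi> \<in> lie_hom (lie_subring L H) A"
    by (simp add: K.lie_Hom_simps)
  have "tra_cocycle \<chi> \<in> B2 (L Quot H) A"
    using 1 by (simp add: Tra_eq Q.H2_class_eq_one_iff tra_cocycle_closed[OF \<chi>])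
  then obtain t where t: "t \<in> carrier (L Quot H) \<rightarrow> carrier A" "t \<zero>\<^bsub>L Quot H\<^esub> = \<zero>\<^bsub>A\<^esub>"
    and tra: "tra_cocycle \<chi> = coboundary (L Quot H) A t"
    by (auto simp: B2_def)
  have tc [simp]: "t u \<in> carrier A" if "u \<in> carrier (L Quot H)" for u
    using t(1) that by auto
  have \<chi>c [simp]: "\<chi> h \<in> carrier A" if "h \<in> H" for h
    using K.hom_closed[OF \<chi>] that by simp
  have \<chi>a: "\<chi> (h \<oplus> k) = \<chi> h \<oplus>\<^bsub>A\<^esub> \<chi> k" if "h \<in> H" "k \<in> H" for h k
    using K.hom_add[OF \<chi>] that by simp
  have tra_bracket: "\<chi> (l u \<otimes> l v \<ominus> l (u \<otimes>\<^bsub>L Quot H\<^esub> v)) = \<ominus>\<^bsub>A\<^esub> t (u \<otimes>\<^bsub>L Quot H\<^esub> v)"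
    and tra_add: "\<chi> (l u \<oplus> l v \<ominus> l (u \<oplus>\<^bsub>L Quot H\<^esub> v)) = t u \<oplus>\<^bsub>A\<^esub> t v \<ominus>\<^bsub>A\<^esub> t (u \<oplus>\<^bsub>L Quot H\<^esub> v)"
    if "u \<in> carrier (L Quot H)" "v \<in> carrier (L Quot H)" for u v
    using fun_cong[OF arg_cong[OF tra, of fst], of "(u, v)"] that
      fun_cong[OF arg_cong[OF tra, of snd], of "(u, v)"]
    by (simp_all add: tra_cocycle_def coboundary_def section_bracket_def section_add_def)
  have diffH: "x \<ominus> l (H +> x) \<in> H" if "x \<in> carrier L" for x
    using that by (simp flip: rcos_eq_iff add: rcos_section section_closed rcos_closed)
  \<comment> \<open>In the splitting x = (x - l u) + l u with u the coset of x, the first summand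
    lies in \<open>H\<close> and is handled by \<chi>; t u serves as the value on
    \<open>l u\<close>.\<close>
  define \<beta> where "\<beta> = (\<lambda>x \<in> carrier L. \<chi> (x \<ominus> l (H +> x)) \<oplus>\<^bsub>A\<^esub> t (H +> x))"
  have "\<beta> \<in> lie_hom L A"
    unfolding lie_hom_iff
  proof (intro conjI ballI)
    fix x y assume xy: "x \<in> carrier L" "y \<in> carrier L"
    let ?u = "H +> x" and ?v = "H +> y"
    have uv: "?u \<in> carrier (L Quot H)" "?v \<in> carrier (L Quot H)"
      using xy by (simp_all add: rcos_closed)
    have luv: "l ?u \<in> carrier L" "l ?v \<in> carrier L" "l (?u \<oplus>\<^bsub>L Quot H\<^esub> ?v) \<in> carrier L"
      using uv by (simp_all add: section_closed)
    \<comment> \<open>The \<open>H\<close>-components of x and y add up to that of x + y only up to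
      the addition defect of \<open>l\<close>. On this defect \<chi> is known from t, and the term t
      (u + v) is absorbed by the definition of \<beta>.\<close>
    have "x \<oplus> y \<ominus> l (?u \<oplus>\<^bsub>L Quot H\<^esub> ?v) =
        (x \<ominus> l ?u) \<oplus> (y \<ominus> l ?v) \<oplus> (l ?u \<oplus> l ?v \<ominus> l (?u \<oplus>\<^bsub>L Quot H\<^esub> ?v))"
      using xy luv by algebra
    then have "\<chi> (x \<oplus> y \<ominus> l (?u \<oplus>\<^bsub>L Quot H\<^esub> ?v)) =
        \<chi> (x \<ominus> l ?u) \<oplus>\<^bsub>A\<^esub> \<chi> (y \<ominus> l ?v) \<oplus>\<^bsub>A\<^esub> (t ?u \<oplus>\<^bsub>A\<^esub> t ?v \<ominus>\<^bsub>A\<^esub> t (?u \<oplus>\<^bsub>L Quot H\<^esub> ?v))"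
      using xy uv by (simp add: \<chi>a diffH section_add_mem tra_add)
    moreover have "\<chi> (x \<ominus> l ?u) \<in> carrier A" "\<chi> (y \<ominus> l ?v) \<in> carrier A" "t ?u \<in> carrier A"
      "t ?v \<in> carrier A" "t (?u \<oplus>\<^bsub>L Quot H\<^esub> ?v) \<in> carrier A"
      using xy uv by (simp_all add: diffH)
    ultimately have "\<chi> (x \<oplus> y \<ominus> l (?u \<oplus>\<^bsub>L Quot H\<^esub> ?v)) \<oplus>\<^bsub>A\<^esub> t (?u \<oplus>\<^bsub>L Quot H\<^esub> ?v) =
        (\<chi> (x \<ominus> l ?u) \<oplus>\<^bsub>A\<^esub> t ?u) \<oplus>\<^bsub>A\<^esub> (\<chi> (y \<ominus> l ?v) \<oplus>\<^bsub>A\<^esub> t ?v)"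
      by (simp add: A.minus_eq A.a_ac A.r_neg)
    then show "\<beta> (x \<oplus> y) = \<beta> x \<oplus>\<^bsub>A\<^esub> \<beta> y"
      using xy by (simp add: \<beta>_def add_Quot)
    \<comment> \<open>By centrality the bracket depends only on the cosets. Hence the
      \<open>H\<close>-component of [x, y] is precisely the bracket defect of \<open>l\<close>, on
      which \<chi> takes the value that cancels t [u, v].\<close>
    have eq: "x \<otimes> y = l ?u \<otimes> l ?v"
      using xy luv by (intro bracket_cong_central) (auto simp: diffH)
    have "\<beta> (x \<otimes> y) = \<chi> (x \<otimes> y \<ominus> l (?u \<otimes>\<^bsub>L Quot H\<^esub> ?v)) \<oplus>\<^bsub>A\<^esub> t (?u \<otimes>\<^bsub>L Quot H\<^esub> ?v)"
      using xy by (simp add: \<beta>_def bracket_closed bracket_Quot)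
    also have "\<dots> = \<chi> (l ?u \<otimes> l ?v \<ominus> l (?u \<otimes>\<^bsub>L Quot H\<^esub> ?v)) \<oplus>\<^bsub>A\<^esub> t (?u \<otimes>\<^bsub>L Quot H\<^esub> ?v)"
      by (simp only: eq)
    also have "\<dots> = \<zero>\<^bsub>A\<^esub>"
      using uv by (simp add: tra_bracket Q.bracket_closed A.l_neg)
    finally show "\<beta> (x \<otimes> y) = \<zero>\<^bsub>A\<^esub>" .
  qed (auto simp: \<beta>_def diffH rcos_closed)
  moreover have "Res_Hom H \<beta> = \<chi>"
  proof (rule extensionalityI[of _ H])
    fix h assume h: "h \<in> H"
    \<comment> \<open>On \<open>H\<close> the coset is zero, so the normalisations l 0 = 0 and t 0 =
      0 reduce \<beta> to \<chi>.\<close>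
    then have "H +> h = \<zero>\<^bsub>L Quot H\<^esub>"
      using a_rcos_const by (simp add: FactRing_def)
    then show "Res_Hom H \<beta> h = \<chi> h"
      using h by (simp add: Res_Hom_def \<beta>_def section_zero t(2) minus_eq minus_zero)
  qed (use \<chi> in \<open>auto simp: Res_Hom_def lie_hom_def PiE_def\<close>)
  ultimately show "\<exists>\<beta> \<in> carrier (lie_Hom L A). Res_Hom H \<beta> = \<chi>"
    by (auto simp: lie_Hom_simps)
qed (simp_all add: comm_group_lie_Hom K.comm_group_lie_Hom Q.comm_group_H2 Res_Hom_hom Tra_hom
    comm_group.axioms(2))

section \<open>Inflation on second cohomology; exactness at H^2(L/H, A)\<close>

lemma inflate_cocycle_closed:
  assumes c: "c \<in> cocycles (L Quot H) A"
  shows "inflate_cocycle L H c \<in> cocycles L A"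
  unfolding cocycles_def inflate_cocycle_def mem_Collect_eq prod.case
proof (intro conjI ballI)
  fix x y z assume xyz: "x \<in> carrier L" "y \<in> carrier L" "z \<in> carrier L"
  note Qxyz = c rcos_closed[OF xyz(1)] rcos_closed[OF xyz(2)] rcos_closed[OF xyz(3)]
  note [simp] = xyz bracket_closed
  note Quot = add_Quot bracket_Quot minus_Quot
  let ?f = "\<lambda>(x, y) \<in> carrier L \<times> carrier L. fst c (H +> x, H +> y)"
  let ?g = "\<lambda>(x, y) \<in> carrier L \<times> carrier L. snd c (H +> x, H +> y)"
  show "?f (x \<oplus> y, z) = ?f (x, z) \<oplus>\<^bsub>A\<^esub> ?f (y, z) \<oplus>\<^bsub>A\<^esub> ?g (x \<otimes> z, y \<otimes> z)"
    using Q.cocycle_bracket_add_left[OF Qxyz] by (simp add: Quot)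
  show "?f (x, y \<oplus> z) = ?f (x, y) \<oplus>\<^bsub>A\<^esub> ?f (x, z) \<oplus>\<^bsub>A\<^esub> ?g (x \<otimes> y, x \<otimes> z)"
    using Q.cocycle_bracket_add_right[OF Qxyz] by (simp add: Quot)
  show "?f (x, x) = \<zero>\<^bsub>A\<^esub>"
    using Q.cocycle_bracket_self[OF Qxyz] by simp
  show "?f (x, y \<otimes> z) \<oplus>\<^bsub>A\<^esub> ?f (z, x \<otimes> y) \<oplus>\<^bsub>A\<^esub> ?f (y, z \<otimes> x) =
      (\<ominus>\<^bsub>A\<^esub> ?g (x \<otimes> (y \<otimes> z), z \<otimes> (x \<otimes> y))) \<ominus>\<^bsub>A\<^esub> ?g (\<ominus> (y \<otimes> (z \<otimes> x)), y \<otimes> (z \<otimes> x))"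
    using Q.cocycle_jacobi[OF Qxyz] by (simp add: Quot)
  show "?g (x \<oplus> y, z) \<oplus>\<^bsub>A\<^esub> ?g (x, y) = ?g (x, y \<oplus> z) \<oplus>\<^bsub>A\<^esub> ?g (y, z)"
    using Q.cocycle_add_assoc[OF Qxyz] by (simp add: Quot)
  show "?g (x, y) = ?g (y, x)"
    using Q.cocycle_add_sym[OF Qxyz] by simp
qed (auto simp: Q.cocycle_closed[OF c] rcos_closed)

lemma inflate_coboundary:
  "inflate_cocycle L H (coboundary (L Quot H) A t) = coboundary L A (\<lambda>x. t (H +> x))"
  by (auto simp: inflate_cocycle_def coboundary_def rcos_closed add_Quot bracket_Quot
      intro!: restrict_ext)

lemma inflate_cocycle_hom: "inflate_cocycle L H \<in> hom (Z2 (L Quot H) A) (Z2 L A)"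
proof (rule homI; unfold Z2_simps Q.Z2_simps)
  fix c d
  show "inflate_cocycle L H
      (\<lambda>p \<in> carrier (L Quot H) \<times> carrier (L Quot H). fst c p \<oplus>\<^bsub>A\<^esub> fst d p,
       \<lambda>p \<in> carrier (L Quot H) \<times> carrier (L Quot H). snd c p \<oplus>\<^bsub>A\<^esub> snd d p) =
      (\<lambda>p \<in> carrier L \<times> carrier L.
        fst (inflate_cocycle L H c) p \<oplus>\<^bsub>A\<^esub> fst (inflate_cocycle L H d) p,
       \<lambda>p \<in> carrier L \<times> carrier L.
        snd (inflate_cocycle L H c) p \<oplus>\<^bsub>A\<^esub> snd (inflate_cocycle L H d) p)"
    by (auto simp: inflate_cocycle_def rcos_closed intro!: restrict_ext)
qed (rule inflate_cocycle_closed)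

text \<open>Inflating the coboundary of t gives the coboundary of t composed with the projection.
  This is the hypothesis that makes inflation well defined on classes.\<close>

lemma inflate_B2: "inflate_cocycle L H ` B2 (L Quot H) A \<subseteq> B2 L A"
proof
  fix c assume "c \<in> inflate_cocycle L H ` B2 (L Quot H) A"
  then obtain t where t: "t \<in> carrier (L Quot H) \<rightarrow> carrier A" "t \<zero>\<^bsub>L Quot H\<^esub> = \<zero>\<^bsub>A\<^esub>"
    and c: "c = coboundary L A (\<lambda>x. t (H +> x))"
    by (auto simp: B2_def inflate_coboundary)
  have "(\<lambda>x. t (H +> x)) \<in> carrier L \<rightarrow> carrier A" "t (H +> \<zero>) = \<zero>\<^bsub>A\<^esub>"
    using t by (auto simp: zero_Quot rcos_closed)
  then show "c \<in> B2 L A"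
    unfolding c B2_def by blast
qed

lemma Inf_H2_class:
  assumes "c \<in> cocycles (L Quot H) A"
  shows "Inf_H2 L H A (H2_class (L Quot H) A c) = H2_class L A (inflate_cocycle L H c)"
proof -
  interpret group_hom "Z2 (L Quot H) A" "Z2 L A" "inflate_cocycle L H"
    using inflate_cocycle_hom by unfold_locales
  show ?thesis
    using induced_coset_map[OF Q.subgroup_B2 subgroup_B2 inflate_B2] assms
    by (simp add: Inf_H2_def H2_class_def Q.Z2_simps)
qed

lemma Inf_H2_hom: "Inf_H2 L H A \<in> hom (H2 (L Quot H) A) (H2 L A)"
proof (rule homI)
  fix C assume "C \<in> carrier (H2 (L Quot H) A)"
  then obtain c where c: "c \<in> cocycles (L Quot H) A" "C = H2_class (L Quot H) A c"
    by (auto simp: Q.carrier_H2)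
  then show "Inf_H2 L H A C \<in> carrier (H2 L A)"
    by (simp add: Inf_H2_class carrier_H2 inflate_cocycle_closed)
  fix D assume "D \<in> carrier (H2 (L Quot H) A)"
  then obtain d where d: "d \<in> cocycles (L Quot H) A" "D = H2_class (L Quot H) A d"
    by (auto simp: Q.carrier_H2)
  have cd: "c \<otimes>\<^bsub>Z2 (L Quot H) A\<^esub> d \<in> cocycles (L Quot H) A"
    using Q.Z.m_closed[of c d] c d by (simp add: Q.Z2_simps)
  have "C \<otimes>\<^bsub>H2 (L Quot H) A\<^esub> D = H2_class (L Quot H) A (c \<otimes>\<^bsub>Z2 (L Quot H) A\<^esub> d)"
    using hom_mult[OF Q.H2_class_hom, of c d] c d by (simp add: Q.Z2_simps(1))
  then have "Inf_H2 L H A (C \<otimes>\<^bsub>H2 (L Quot H) A\<^esub> D) =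
      H2_class L A (inflate_cocycle L H (c \<otimes>\<^bsub>Z2 (L Quot H) A\<^esub> d))"
    by (simp add: Inf_H2_class cd)
  also have "\<dots> = H2_class L A (inflate_cocycle L H c \<otimes>\<^bsub>Z2 L A\<^esub> inflate_cocycle L H d)"
    using hom_mult[OF inflate_cocycle_hom, of c d] c d by (simp add: Q.Z2_simps(1))
  also have "\<dots> = Inf_H2 L H A C \<otimes>\<^bsub>H2 L A\<^esub> Inf_H2 L H A D"
    using hom_mult[OF H2_class_hom, of "inflate_cocycle L H c" "inflate_cocycle L H d"] c d
    by (simp add: Z2_simps(1) inflate_cocycle_closed Inf_H2_class)
  finally show "Inf_H2 L H A (C \<otimes>\<^bsub>H2 (L Quot H) A\<^esub> D) = Inf_H2 L H A C \<otimes>\<^bsub>H2 L A\<^esub> Inf_H2 L H A D" .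
qed

text \<open>Pulled back to \<open>L\<close>, the section becomes x \<mapsto>
  \<open>l (H +> x)\<close>, which differs from the identity by a map into \<open>H\<close>. The
  identity has no defect, so the defect of the pulled-back section is the coboundary of that
  difference.\<close>

lemma inflate_tra_cocycle:
  assumes \<chi>: "\<chi> \<in> lie_hom (lie_subring L H) A"
  shows "inflate_cocycle L H (tra_cocycle \<chi>) = coboundary L A (\<lambda>x. \<chi> (l (H +> x) \<ominus> x))"
proof -
  have \<chi>c: "\<chi> h \<in> carrier A" if "h \<in> H" for h
    using K.hom_closed[OF \<chi>] that by simp
  have \<chi>a: "\<chi> (h \<oplus> k) = \<chi> h \<oplus>\<^bsub>A\<^esub> \<chi> k" if "h \<in> H" "k \<in> H" for h k
    using K.hom_add[OF \<chi>] that by simp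
  have \<chi>m: "\<chi> (\<ominus> h) = \<ominus>\<^bsub>A\<^esub> \<chi> h" if "h \<in> H" for h
    using K.hom_minus[OF \<chi>] minus_subring that by simp
  have "\<chi> (l (H +> x) \<otimes> l (H +> y) \<ominus> l (H +> x \<otimes> y)) = \<ominus>\<^bsub>A\<^esub> \<chi> (l (H +> x \<otimes> y) \<ominus> x \<otimes> y)"
    if xy: "x \<in> carrier L" "y \<in> carrier L" for x y
  proof -
    have c: "l (H +> x \<otimes> y) \<in> carrier L" "x \<otimes> y \<in> carrier L"
      using xy by (simp_all add: section_closed rcos_closed bracket_closed)
    have "l (H +> x) \<otimes> l (H +> y) = x \<otimes> y"
      using xy by (intro bracket_cong_central) (auto simp: section_closed rcos_closed section_rcos_diff)
    moreover have "x \<otimes> y \<ominus> l (H +> x \<otimes> y) = \<ominus> (l (H +> x \<otimes> y) \<ominus> x \<otimes> y)"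
      using c by (simp add: minus_eq minus_add a_ac)
    ultimately show ?thesis
      using xy by (simp add: \<chi>m section_rcos_diff bracket_closed)
  qed
  moreover have "\<chi> (l (H +> x) \<oplus> l (H +> y) \<ominus> l (H +> (x \<oplus> y))) =
      \<chi> (l (H +> x) \<ominus> x) \<oplus>\<^bsub>A\<^esub> \<chi> (l (H +> y) \<ominus> y) \<ominus>\<^bsub>A\<^esub> \<chi> (l (H +> (x \<oplus> y)) \<ominus> (x \<oplus> y))"
    if xy: "x \<in> carrier L" "y \<in> carrier L" for x y
  proof -
    have c: "l (H +> x) \<in> carrier L" "l (H +> y) \<in> carrier L" "l (H +> (x \<oplus> y)) \<in> carrier L"
      using xy by (simp_all add: section_closed rcos_closed)
    have "l (H +> x) \<oplus> l (H +> y) \<ominus> l (H +> (x \<oplus> y)) =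
        (l (H +> x) \<ominus> x) \<oplus> (l (H +> y) \<ominus> y) \<oplus> \<ominus> (l (H +> (x \<oplus> y)) \<ominus> (x \<oplus> y))"
      using xy c by algebra
    then show ?thesis
      using xy by (simp add: \<chi>a \<chi>m section_rcos_diff A.minus_eq)
  qed
  ultimately show ?thesis
    by (auto simp: inflate_cocycle_def tra_cocycle_def coboundary_def section_bracket_def
        section_add_def rcos_closed add_Quot bracket_Quot intro!: restrict_ext)
qed

lemma exact_at_H2:
  "exact_at (lie_Hom (lie_subring L H) A) (Tra L H A l) (H2 (L Quot H) A) (Inf_H2 L H A) (H2 L A)"
proof (rule exact_atI)
  fix \<chi> assume "\<chi> \<in> carrier (lie_Hom (lie_subring L H) A)"
  then have \<chi>: "\<chi> \<in> lie_hom (lie_subring L H) A"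
    by (simp add: K.lie_Hom_simps)
  \<comment> \<open>\<open>B2\<close> is built from maps vanishing at 0; the normalisation of the
    section ensures this here.\<close>
  have "l (H +> \<zero>) = \<zero>"
    by (simp flip: zero_Quot add: section_zero)
  then have "\<chi> (l (H +> \<zero>) \<ominus> \<zero>) = \<zero>\<^bsub>A\<^esub>"
    using K.hom_zero[OF \<chi>] by (simp add: minus_eq minus_zero)
  moreover have "(\<lambda>x. \<chi> (l (H +> x) \<ominus> x)) \<in> carrier L \<rightarrow> carrier A"
    using K.hom_closed[OF \<chi>] by (auto simp: section_rcos_diff)
  ultimately have "inflate_cocycle L H (tra_cocycle \<chi>) \<in> B2 L A"
    unfolding inflate_tra_cocycle[OF \<chi>] B2_def by blast
  then show "Inf_H2 L H A (Tra L H A l \<chi>) = \<one>\<^bsub>H2 L A\<^esub>"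
    by (simp add: Tra_eq Inf_H2_class tra_cocycle_closed \<chi> H2_class_eq_one_iff inflate_cocycle_closed)
next
  fix C assume "C \<in> carrier (H2 (L Quot H) A)" and 1: "Inf_H2 L H A C = \<one>\<^bsub>H2 L A\<^esub>"
  then obtain c where c: "c \<in> cocycles (L Quot H) A" and C: "C = H2_class (L Quot H) A c"
    by (auto simp: Q.carrier_H2)
  have "inflate_cocycle L H c \<in> B2 L A"
    using 1 c by (simp add: C Inf_H2_class H2_class_eq_one_iff inflate_cocycle_closed)
  then obtain t where t: "t \<in> carrier L \<rightarrow> carrier A" "t \<zero> = \<zero>\<^bsub>A\<^esub>"
    and infl: "inflate_cocycle L H c = coboundary L A t"
    by (auto simp: B2_def)
  have tc [simp]: "t x \<in> carrier A" if "x \<in> carrier L" for x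
    using t(1) that by auto
  have f: "fst c (H +> x, H +> y) = \<ominus>\<^bsub>A\<^esub> t (x \<otimes> y)"
    and g: "snd c (H +> x, H +> y) = t x \<oplus>\<^bsub>A\<^esub> t y \<ominus>\<^bsub>A\<^esub> t (x \<oplus> y)"
    if "x \<in> carrier L" "y \<in> carrier L" for x y
    using fun_cong[OF arg_cong[OF infl, of fst], of "(x, y)"] that
      fun_cong[OF arg_cong[OF infl, of snd], of "(x, y)"]
    by (simp_all add: inflate_cocycle_def coboundary_def)
  \<comment> \<open>Since h and 0 lie in the same coset, \<open>g\<close> gives the same expression
    for (h, x) and for (0, x), and the latter vanishes because t 0 = 0.\<close>
  have ta: "t (h \<oplus> x) = t h \<oplus>\<^bsub>A\<^esub> t x" if h: "h \<in> H" and x: "x \<in> carrier L" for h x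
  proof -
    have "H +> h = H +> \<zero>"
      using h a_rcos_const by simp
    then have "t h \<oplus>\<^bsub>A\<^esub> t x \<ominus>\<^bsub>A\<^esub> t (h \<oplus> x) = t \<zero> \<oplus>\<^bsub>A\<^esub> t x \<ominus>\<^bsub>A\<^esub> t (\<zero> \<oplus> x)"
      using g[of h x] g[of \<zero> x] h x by simp
    also have "\<dots> = \<zero>\<^bsub>A\<^esub>"
      using x by (simp add: t(2) A.minus_eq A.r_neg)
    finally have "t h \<oplus>\<^bsub>A\<^esub> t x = \<ominus>\<^bsub>A\<^esub> (\<ominus>\<^bsub>A\<^esub> t (h \<oplus> x))"
      using h x A.minus_equality[of "t h \<oplus>\<^bsub>A\<^esub> t x" "\<ominus>\<^bsub>A\<^esub> t (h \<oplus> x)"] by (simp add: A.minus_eq)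
    then show ?thesis
      using h x by simp
  qed
  \<comment> \<open>The subtractive form is the one that applies to the defects of \<open>l\<close>,
    which are differences lying in \<open>H\<close>.\<close>
  have td: "t (x \<ominus> y) = t x \<ominus>\<^bsub>A\<^esub> t y" if "x \<in> carrier L" "y \<in> carrier L" "x \<ominus> y \<in> H" for x y
  proof -
    have "x = (x \<ominus> y) \<oplus> y"
      using that(1,2) by algebra
    then have "t x = t (x \<ominus> y) \<oplus>\<^bsub>A\<^esub> t y"
      using ta[of "x \<ominus> y" y] that by simp
    then show ?thesis
      using that by (simp add: A.minus_eq A.a_assoc A.r_neg)
  qed
  \<comment> \<open>Additivity comes from \<open>ta\<close>. Compatibility with brackets holds
    because brackets within \<open>H\<close> are zero and t 0 = 0.\<close>
  define \<chi> where "\<chi> = (\<lambda>h \<in> H. \<ominus>\<^bsub>A\<^esub> t h)"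
  have \<chi>: "\<chi> \<in> lie_hom (lie_subring L H) A"
    by (auto simp: K.lie_hom_iff \<chi>_def ta t(2) bracket_left bracket_central_left A.minus_add
        A.minus_zero)
  have s: "(\<lambda>u. t (l u)) \<in> carrier (L Quot H) \<rightarrow> carrier A" "t (l \<zero>\<^bsub>L Quot H\<^esub>) = \<zero>\<^bsub>A\<^esub>"
    by (auto simp: section_closed section_zero t(2))
  \<comment> \<open>By \<open>td\<close>, \<chi> of a defect is a difference of two values of t; one
    of them cancels against the coboundary of t composed with \<open>l\<close>. What remains is the
    formula for c at the representatives \<open>l u\<close> and \<open>l v\<close>.\<close>
  have "coboundary (L Quot H) A (\<lambda>u. t (l u)) \<otimes>\<^bsub>Z2 (L Quot H) A\<^esub> tra_cocycle \<chi> = c"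
  proof (rule prod_eqI; rule extensionalityI[of _ "carrier (L Quot H) \<times> carrier (L Quot H)"])
    fix p assume "p \<in> carrier (L Quot H) \<times> carrier (L Quot H)"
    then obtain u v where p: "p = (u, v)" and uv: "u \<in> carrier (L Quot H)" "v \<in> carrier (L Quot H)"
      by auto
    note [simp] = uv section_closed Q.bracket_closed bracket_closed
    have cancel: "a \<oplus>\<^bsub>A\<^esub> (b \<oplus>\<^bsub>A\<^esub> \<ominus>\<^bsub>A\<^esub> a) = b" if "a \<in> carrier A" "b \<in> carrier A" for a b
      using that by algebra
    note simps = p Q.Z2_simps coboundary_def tra_cocycle_def section_bracket_def section_add_def \<chi>_def
      section_bracket_mem section_add_mem td A.minus_eq A.minus_add
    have "fst c (u, v) = \<ominus>\<^bsub>A\<^esub> t (l u \<otimes> l v)"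
      using f[of "l u" "l v"] by (simp add: rcos_section)
    then show "fst (coboundary (L Quot H) A (\<lambda>u. t (l u)) \<otimes>\<^bsub>Z2 (L Quot H) A\<^esub> tra_cocycle \<chi>) p = fst c p"
      by (simp add: simps cancel A.a_ac)
    have "snd c (u, v) = t (l u) \<oplus>\<^bsub>A\<^esub> t (l v) \<ominus>\<^bsub>A\<^esub> t (l u \<oplus> l v)"
      using g[of "l u" "l v"] by (simp add: rcos_section)
    then show "snd (coboundary (L Quot H) A (\<lambda>u. t (l u)) \<otimes>\<^bsub>Z2 (L Quot H) A\<^esub> tra_cocycle \<chi>) p = snd c p"
      by (simp add: simps cancel A.a_ac)
  qed (auto simp: Q.Z2_simps Q.cocycle_extensional[OF c])
  then have "Tra L H A l \<chi> = C"
    using Q.H2_class_mult_coboundary[OF tra_cocycle_closed[OF \<chi>] s] by (simp add: Tra_eq C)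
  then show "\<exists>\<chi> \<in> carrier (lie_Hom (lie_subring L H) A). Tra L H A l \<chi> = C"
    using \<chi> by (auto simp: K.lie_Hom_simps)
qed (simp_all add: K.comm_group_lie_Hom Q.comm_group_H2 comm_group_H2 Inf_H2_hom Tra_hom
    comm_group.axioms(2))

text \<open>The initial zero of the sequence is the one-element group, so exactness here expresses
  the injectivity of inflation.\<close>

lemma exact_at_Hom_Quot:
  "exact_at (singleton_group ()) (\<lambda>_. \<one>\<^bsub>lie_Hom (L Quot H) A\<^esub>)
    (lie_Hom (L Quot H) A) (Inf_Hom L H) (lie_Hom L A)"
proof (rule exact_atI)
  interpret G: comm_group "lie_Hom (L Quot H) A"
    by (rule Q.comm_group_lie_Hom)
  show "(\<lambda>_. \<one>\<^bsub>lie_Hom (L Quot H) A\<^esub>) \<in> hom (singleton_group ()) (lie_Hom (L Quot H) A)"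
    by (auto intro: homI)
  show "Inf_Hom L H \<one>\<^bsub>lie_Hom (L Quot H) A\<^esub> = \<one>\<^bsub>lie_Hom L A\<^esub>"
    by (auto simp: Inf_Hom_def lie_Hom_simps Q.lie_Hom_simps rcos_closed intro!: restrict_ext)
qed (use Inf_Hom_eq_one in \<open>auto simp: comm_group_lie_Hom Q.comm_group_lie_Hom Inf_Hom_hom
    Q.lie_Hom_simps(1) comm_group.axioms(2)\<close>)

end

section \<open>The five-term exact sequence\<close>

theorem theorem1p1:
  fixes L :: "('a, 'm) ring_scheme" and A :: "('b, 'n) ring_scheme"
    and H :: "'a set" and l :: "'a set \<Rightarrow> 'a"
  assumes "lie_ring L"
    and "abelian_lie_ring A"
    and "central_lie_ideal H L"
    and "lie_section L H l"
  shows "comm_group (lie_Hom (L Quot H) A) \<and>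
    comm_group (lie_Hom L A) \<and>
    comm_group (lie_Hom (lie_subring L H) A) \<and>
    comm_group (H2 (L Quot H) A) \<and>
    comm_group (H2 L A) \<and>
    exact_at (singleton_group ()) (\<lambda>_. \<one>\<^bsub>lie_Hom (L Quot H) A\<^esub>)
      (lie_Hom (L Quot H) A) (Inf_Hom L H) (lie_Hom L A) \<and>
    exact_at (lie_Hom (L Quot H) A) (Inf_Hom L H)
      (lie_Hom L A) (Res_Hom H) (lie_Hom (lie_subring L H) A) \<and>
    exact_at (lie_Hom L A) (Res_Hom H)
      (lie_Hom (lie_subring L H) A) (Tra L H A l) (H2 (L Quot H) A) \<and>
    exact_at (lie_Hom (lie_subring L H) A) (Tra L H A l)
      (H2 (L Quot H) A) (Inf_H2 L H A) (H2 L A)"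
proof -
  interpret lie_central_extension H L A l
    by (intro lie_central_extension.intro lie_ring_central_ideal.intro lie_trivial_coefficients.intro
        lie_central_extension_axioms.intro assms)
  show ?thesis
    by (intro conjI comm_group_lie_Hom Q.comm_group_lie_Hom K.comm_group_lie_Hom comm_group_H2
        Q.comm_group_H2 exact_at_Hom_Quot exact_at_Hom exact_at_Hom_subring exact_at_H2)
qed

end
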